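(* Let $\tau>0$, let $\beta>0$ be a real constant, let $V\in L^\infty(\mathcal D)$ with $V\ge0$, let $M>0$ be the truncation constant, and let $\kappa\ge\|V\|_\infty+3\beta M^2$. Let $\phi^0\in L^2(\mathcal D)$ with $\|\phi^0\|_2=1$, and let $(\phi^n)_{n\ge0}$ be generated by $$\phi^{n+1}=\frac{\frac1\tau\big(-e^{\tau\Delta}\phi^n+4e^{\frac\tau2\Delta}\phi^n\big)-2V\phi^n-\frac\beta2\widetilde f(\phi^n)+2\kappa\phi^n}{\Big\|\frac1\tau\big(-e^{\tau\Delta}\phi^n+4e^{\frac\tau2\Delta}\phi^n\big)-2V\phi^n-\frac\beta2\widetilde f(\phi^n)+2\kappa\phi^n\Big\|_2},\qquad n\ge0.$$ Then $$\widetilde E^{2,\tau}(\phi^{n+1})\le\widetilde E^{2,\tau}(\phi^n),\qquad n\ge0.$$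
   Context: $\mathcal D\subset\mathbb R^d$, $d\in\{1,2,3\}$, is a bounded domain (an interval for $d=1$, a rectangle for $d=2$, a box for $d=3$), with periodic boundary conditions imposed on all functions. Functions are complex-valued; $\|\cdot\|_2$, $\|\cdot\|_\infty$ are the norms of $L^2(\mathcal D)$, $L^\infty(\mathcal D)$. $e^{t\Delta}$, $t\ge 0$, denotes the heat semigroup on $L^2(\mathcal D)$ generated by the Laplacian with periodic boundary conditions. For a fixed constant $M>0$, the truncated nonlinearity and its derivative are $$\widetilde F(\phi)=\begin{cases}|\phi|^4,&|\phi|\le M,\\ 6M^2|\phi|^2-8M^3|\phi|+3M^4,&|\phi|>M,\end{cases}\qquad \widetilde f(\phi)=\begin{cases}4|\phi|^2\phi,&|\phi|\le M,\\ 12M^2\phi-8M^3\frac{\phi}{|\phi|},&|\phi|>M.\end{cases}$$ The truncated second-order relaxed energy is $$\widetilde E^{2,\tau}(\phi)=\frac3{2\tau}+\int_{\mathcal D}\Big[\frac1{2\tau}\Big(\big|e^{\frac\tau2\Delta}\phi\big|^2-4\big|e^{\frac\tau4\Delta}\phi\big|^2\Big)+V(x)|\phi|^2+\frac\beta2\widetilde F(\phi)-\kappa|\phi|^2\Big]\,dx+\kappa.$$ *)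

theory Defs
  imports "HOL-Analysis.Analysis" "HOL-Probability.Essential_Supremum"
begin

section \<open>Square-integrable functions\<close>

text \<open>Elements of $L^2$ are represented by functions; identities between them are meant almost
  everywhere.\<close>

definition L2_space :: "'a measure \<Rightarrow> ('a \<Rightarrow> complex) set" where
  "L2_space D = {u \<in> borel_measurable D. integrable D (\<lambda>x. (cmod (u x))\<^sup>2)}"

definition L2_norm :: "'a measure \<Rightarrow> ('a \<Rightarrow> complex) \<Rightarrow> real" where
  "L2_norm D u = sqrt (LINT x|D. (cmod (u x))\<^sup>2)"

definition Linf_norm :: "'a measure \<Rightarrow> ('a \<Rightarrow> real) \<Rightarrow> ereal" where
  "Linf_norm D V = esssup D (\<lambda>x. ereal \<bar>V x\<bar>)"

section \<open>The Laplacian with periodic boundary conditions\<close>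

definition partial_deriv :: "'d \<Rightarrow> (real ^ 'd \<Rightarrow> complex) \<Rightarrow> real ^ 'd \<Rightarrow> complex" where
  "partial_deriv i f x = vector_derivative (\<lambda>t. f (x + t *\<^sub>R axis i 1)) (at 0)"

primrec Ck :: "nat \<Rightarrow> (real ^ 'd \<Rightarrow> complex) \<Rightarrow> bool" where
  "Ck 0 f \<longleftrightarrow> continuous_on UNIV f"
| "Ck (Suc k) f \<longleftrightarrow> continuous_on UNIV f \<and>
     (\<forall>i. (\<forall>x. (\<lambda>t. f (x + t *\<^sub>R axis i 1)) differentiable (at 0)) \<and> Ck k (partial_deriv i f))"

definition smooth_periodic :: "real ^ 'd \<Rightarrow> real ^ 'd \<Rightarrow> (real ^ 'd \<Rightarrow> complex) \<Rightarrow> bool" where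
  "smooth_periodic a b f \<longleftrightarrow>
     (\<forall>k. Ck k f) \<and> (\<forall>i x. f (x + (b $ i - a $ i) *\<^sub>R axis i 1) = f x)"

definition laplacian :: "(real ^ 'd \<Rightarrow> complex) \<Rightarrow> real ^ 'd \<Rightarrow> complex" where
  "laplacian f x = (\<Sum>i\<in>UNIV. partial_deriv i (partial_deriv i f) x)"

text \<open>The graph of the periodic Laplacian as an unbounded operator on $L^2$ of the box: the closure in
  $L^2 \times L^2$ of the classical Laplacian on smooth periodic functions. Its domain is the periodic
  Sobolev space $H^2$, the completion of the smooth periodic functions in the $H^2$-norm, because this
  norm is equivalent on them to the graph norm.\<close>

definition periodic_laplacian ::
  "real ^ 'd \<Rightarrow> real ^ 'd \<Rightarrow> ((real ^ 'd \<Rightarrow> complex) \<times> (real ^ 'd \<Rightarrow> complex)) set" where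
  "periodic_laplacian a b =
     (let D = lebesgue_on (box a b) in
      {(u, g). u \<in> L2_space D \<and> g \<in> L2_space D \<and>
         (\<forall>\<epsilon>>0. \<exists>\<psi>. smooth_periodic a b \<psi> \<and>
            L2_norm D (\<lambda>x. \<psi> x - u x) < \<epsilon> \<and> L2_norm D (\<lambda>x. laplacian \<psi> x - g x) < \<epsilon>)})"

section \<open>The heat semigroup\<close>

definition C0_semigroup :: "'a measure \<Rightarrow> (real \<Rightarrow> ('a \<Rightarrow> complex) \<Rightarrow> 'a \<Rightarrow> complex) \<Rightarrow> bool" where
  "C0_semigroup D S \<longleftrightarrow>
     (\<forall>t\<ge>0. \<forall>u\<in>L2_space D. S t u \<in> L2_space D) \<and>
     (\<forall>t\<ge>0. \<forall>u\<in>L2_space D. \<forall>v\<in>L2_space D. \<forall>c d.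
        AE x in D. S t (\<lambda>y. c * u y + d * v y) x = c * S t u x + d * S t v x) \<and>
     (\<forall>t\<ge>0. \<exists>C. \<forall>u\<in>L2_space D. L2_norm D (S t u) \<le> C * L2_norm D u) \<and>
     (\<forall>u\<in>L2_space D. AE x in D. S 0 u x = u x) \<and>
     (\<forall>s\<ge>0. \<forall>t\<ge>0. \<forall>u\<in>L2_space D. AE x in D. S (s + t) u x = S s (S t u) x) \<and>
     (\<forall>u\<in>L2_space D. ((\<lambda>t. L2_norm D (\<lambda>x. S t u x - u x)) \<longlongrightarrow> 0) (at_right 0))"

text \<open>The graph of the infinitesimal generator.\<close>

definition generator ::
  "'a measure \<Rightarrow> (real \<Rightarrow> ('a \<Rightarrow> complex) \<Rightarrow> 'a \<Rightarrow> complex) \<Rightarrow> (('a \<Rightarrow> complex) \<times> ('a \<Rightarrow> complex)) set" where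
  "generator D S =
     {(u, g). u \<in> L2_space D \<and> g \<in> L2_space D \<and>
        ((\<lambda>h. L2_norm D (\<lambda>x. (S h u x - u x) / of_real h - g x)) \<longlongrightarrow> 0) (at_right 0)}"

text \<open>\<open>S t\<close> plays the role of $e^{t\Delta}$. As a semigroup is determined by its generator, the
  predicate fixes \<open>S t u\<close> up to null sets for \<open>t \<ge> 0\<close> and \<open>u\<close> in $L^2$.\<close>

definition heat_semigroup ::
  "real ^ 'd \<Rightarrow> real ^ 'd \<Rightarrow> (real \<Rightarrow> (real ^ 'd \<Rightarrow> complex) \<Rightarrow> real ^ 'd \<Rightarrow> complex) \<Rightarrow> bool" where
  "heat_semigroup a b S \<longleftrightarrow>
     C0_semigroup (lebesgue_on (box a b)) S \<and>
     generator (lebesgue_on (box a b)) S = periodic_laplacian a b"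

section \<open>Truncated nonlinearity, energy and iteration\<close>

definition F_trunc :: "real \<Rightarrow> complex \<Rightarrow> real" where
  "F_trunc M z =
     (if cmod z \<le> M then (cmod z)^4
      else 6 * M\<^sup>2 * (cmod z)\<^sup>2 - 8 * M^3 * cmod z + 3 * M^4)"

definition f_trunc :: "real \<Rightarrow> complex \<Rightarrow> complex" where
  "f_trunc M z =
     (if cmod z \<le> M then 4 * of_real ((cmod z)\<^sup>2) * z
      else 12 * of_real (M\<^sup>2) * z - 8 * of_real (M^3) * (z / of_real (cmod z)))"

definition energy ::
  "'a measure \<Rightarrow> (real \<Rightarrow> ('a \<Rightarrow> complex) \<Rightarrow> 'a \<Rightarrow> complex) \<Rightarrow> ('a \<Rightarrow> real) \<Rightarrow>
   real \<Rightarrow> real \<Rightarrow> real \<Rightarrow> real \<Rightarrow> ('a \<Rightarrow> complex) \<Rightarrow> real" where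
  "energy D S V \<beta> M \<kappa> \<tau> u =
     3 / (2 * \<tau>)
     + (LINT x|D. 1 / (2 * \<tau>) * ((cmod (S (\<tau>/2) u x))\<^sup>2 - 4 * (cmod (S (\<tau>/4) u x))\<^sup>2)
          + V x * (cmod (u x))\<^sup>2 + \<beta> / 2 * F_trunc M (u x) - \<kappa> * (cmod (u x))\<^sup>2)
     + \<kappa>"

definition unnormalized_step ::
  "(real \<Rightarrow> ('a \<Rightarrow> complex) \<Rightarrow> 'a \<Rightarrow> complex) \<Rightarrow> ('a \<Rightarrow> real) \<Rightarrow>
   real \<Rightarrow> real \<Rightarrow> real \<Rightarrow> real \<Rightarrow> ('a \<Rightarrow> complex) \<Rightarrow> 'a \<Rightarrow> complex" where
  "unnormalized_step S V \<beta> M \<kappa> \<tau> u x =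
     1 / of_real \<tau> * (- S \<tau> u x + 4 * S (\<tau>/2) u x)
     - 2 * of_real (V x) * u x - of_real (\<beta> / 2) * f_trunc M (u x) + 2 * of_real \<kappa> * u x"

end

theory Submission
  imports Defs
begin

text \<open>The energy is a concave functional on $L^2$, and each step of the iteration minimises its linearisation
over the unit ball.

Write $\langle u,v\rangle$ for the real inner product $\mathrm{Re}\int u\bar v$ and $G(u)$ for the
unnormalised step. Formally $G(u)$ is minus the gradient of the energy at $u$, and concavity is the
tangent inequality $E(w) \<le> E(u) - \langle G(u), w-u\rangle$ (lemma \<open>energy_tangent\<close>). For
$w = G(u)/\|G(u)\|$ one has $\langle G(u),w\rangle = \|G(u)\|$, while
$\langle G(u),u\rangle \<le> \|G(u)\|$ by Cauchy--Schwarz as soon as $\|u\| \<le> 1$. Hence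
$E(w) \<le> E(u)$. With division by zero giving zero, this also covers the degenerate case $G(u)=0$,
where $w=0$; so the invariant carried along the iteration is $\|\phi^n\| \<le> 1$ rather than
$\|\phi^n\| = 1$.

Concavity has two sources. The second differences of the potential part are at most those of
$(V + 3\beta M^2 - \kappa)|u|^2$, and the assumption on $\kappa$ makes this coefficient nonpositive; it
suffices that $\widetilde F$ lies below its tangent plus $6M^2$ times the squared distance
(\<open>F_trunc_tangent\<close>). The quadratic form $\|e^{\frac\tau2\Delta}u\|^2 - 4\|e^{\frac\tau4\Delta}u\|^2$
is nonpositive because $e^{t\Delta}$ is a contraction, and its gradient has the form used in the step
because $e^{t\Delta}$ is symmetric.

The analytic work is therefore to derive symmetry and contractivity from the description of $e^{t\Delta}$
as a strongly continuous semigroup whose generator is the periodic Laplacian. The periodic exponentials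
are eigenfunctions of the generator, so $e^{t\Delta}$ multiplies each of them by
$e^{-|\xi|^2t}$ (\<open>C0_semigroup_eigenvector\<close>). This needs a bound on the semigroup that is uniform near
time zero, which comes from the uniform boundedness principle and hence from the completeness of $L^2$
(\<open>L2_complete\<close>, \<open>uniform_boundedness\<close>). The exponentials are orthogonal, which gives both properties on
trigonometric sums, and trigonometric sums are dense in $L^2$ of the box by the Stone--Weierstrass
theorem on the torus (\<open>trig_poly_dense\<close>), which gives them everywhere.\<close>

section \<open>The truncated nonlinearity\<close>

text \<open>On the half-line \<open>F\<close> is twice continuously differentiable with $F'' \<le> 12M^2$, so this is Taylor's inequality. Each of the
four positions of \<open>r\<close> and \<open>s\<close> relative to \<open>M\<close> has an explicit factorisation of the defect; the outer piece
of \<open>F\<close> is exactly the second-order Taylor polynomial of $t^4$ at \<open>M\<close>.\<close>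

lemma F_trunc_tangent_scalar:
  fixes r s M :: real
  assumes M: "M > 0" and r: "0 \<le> r" and s: "0 \<le> s"
  defines "F \<equiv> \<lambda>t. if t \<le> M then t^4 else 6 * M\<^sup>2 * t\<^sup>2 - 8 * M^3 * t + 3 * M^4"
    and "F' \<equiv> \<lambda>t. if t \<le> M then 4 * t^3 else 12 * M\<^sup>2 * t - 8 * M^3"
  shows "F s \<le> F r + F' r * (s - r) + 6 * M\<^sup>2 * (s - r)\<^sup>2"
proof -
  consider "r \<le> M" "s \<le> M" | "r > M" "s > M" | "r \<le> M" "s > M" | "r > M" "s \<le> M" by linarith
  then show ?thesis
  proof cases
    case 1
    have "s\<^sup>2 + 2 * (s * r) + 3 * r\<^sup>2 \<le> M\<^sup>2 + 2 * (M * M) + 3 * M\<^sup>2"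
      using 1 r s M by (intro add_mono mult_left_mono mult_mono power_mono) auto
    then have "(s - r)\<^sup>2 * (s\<^sup>2 + 2 * (s * r) + 3 * r\<^sup>2) \<le> (s - r)\<^sup>2 * (6 * M\<^sup>2)"
      by (intro mult_left_mono) (auto simp: power2_eq_square)
    also have "(s - r)\<^sup>2 * (s\<^sup>2 + 2 * (s * r) + 3 * r\<^sup>2) = s^4 - (r^4 + 4 * r^3 * (s - r))"
      by (simp add: power2_eq_square power3_eq_cube power4_eq_xxxx algebra_simps)
    finally show ?thesis using 1 by (simp add: F_def F'_def mult.commute)
  next
    case 2
    then show ?thesis by (simp add: F_def F'_def) (simp add: algebra_simps power2_eq_square)
  next
    case 3
    have "3 * (M + r)\<^sup>2 \<le> 4 * M * (2 * M + r)"
    proof -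
      have "0 \<le> (M - r) * (5 * M + 3 * r)" using 3 r M by simp
      then show ?thesis by (simp add: power2_eq_square algebra_simps)
    qed
    also have "\<dots> \<le> 4 * s * (2 * M + r)" using 3 r M by (intro mult_right_mono) auto
    finally have "0 \<le> (M - r)\<^sup>2 * (4 * s * (2 * M + r) - 3 * (M + r)\<^sup>2)" by simp
    also have "\<dots> = r^4 + 4 * r^3 * (s - r) + 6 * M\<^sup>2 * (s - r)\<^sup>2 - (6 * M\<^sup>2 * s\<^sup>2 - 8 * M^3 * s + 3 * M^4)"
      by (simp add: power2_eq_square power3_eq_cube power4_eq_xxxx algebra_simps)
    finally show ?thesis using 3 by (simp add: F_def F'_def)
  next
    case 4
    \<comment> \<open>The outer branch of \<open>F\<close> exceeds $s^4$ at \<open>s\<close>, and on that branch the tangent inequality is an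
      equality.\<close>
    have "0 \<le> (M - s)^3 * (s + 3 * M)" using 4 s M by simp
    also have "\<dots> = 6 * M\<^sup>2 * s\<^sup>2 - 8 * M^3 * s + 3 * M^4 - s^4"
      by (simp add: power2_eq_square power3_eq_cube power4_eq_xxxx algebra_simps)
    also have "\<dots> = (6 * M\<^sup>2 * r\<^sup>2 - 8 * M^3 * r + 3 * M^4) + (12 * M\<^sup>2 * r - 8 * M^3) * (s - r)
        + 6 * M\<^sup>2 * (s - r)\<^sup>2 - s^4"
      by (simp add: power2_eq_square power3_eq_cube power4_eq_xxxx algebra_simps)
    finally show ?thesis using 4 by (simp add: F_def F'_def)
  qed
qed

text \<open>The truncated nonlinearity is a radial rescaling of its argument; this is the scaling factor at modulus
\<open>r\<close>.\<close>

definition f_factor :: "real \<Rightarrow> real \<Rightarrow> real" where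
  "f_factor M r = (if r \<le> M then 4 * r\<^sup>2 else 12 * M\<^sup>2 - 8 * M^3 / r)"

lemma f_trunc_eq_factor: "f_trunc M z = of_real (f_factor M (cmod z)) * z"
  by (simp add: f_trunc_def f_factor_def left_diff_distrib)

lemma f_factor_bounds:
  assumes "M > 0" "r \<ge> 0" shows "0 \<le> f_factor M r" "f_factor M r \<le> 12 * M\<^sup>2"
proof -
  have 1: "r\<^sup>2 \<le> M\<^sup>2" if "r \<le> M" using assms that by (intro power_mono) auto
  have 2: "8 * M^3 / r \<le> 8 * M\<^sup>2" if "r > M"
  proof -
    have "8 * M^3 / r \<le> 8 * M^3 / M" using assms that by (intro divide_left_mono) auto
    then show ?thesis using assms by (simp add: power2_eq_square power3_eq_cube)
  qed
  have 3: "0 \<le> M\<^sup>2" "0 \<le> 8 * M^3 / r" "0 \<le> r\<^sup>2" using assms by simp_all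
  show "0 \<le> f_factor M r"
  proof (cases "r \<le> M")
    case False
    then have "0 \<le> 12 * M\<^sup>2 - 8 * M^3 / r" using 2 3 by linarith
    then show ?thesis using False by (simp add: f_factor_def)
  qed (simp add: f_factor_def)
  show "f_factor M r \<le> 12 * M\<^sup>2"
  proof (cases "r \<le> M")
    case True
    then have "4 * r\<^sup>2 \<le> 12 * M\<^sup>2" using 1 3 by linarith
    then show ?thesis using True by (simp add: f_factor_def)
  next
    case False
    then have "12 * M\<^sup>2 - 8 * M^3 / r \<le> 12 * M\<^sup>2" using 3 by linarith
    then show ?thesis using False by (simp add: f_factor_def)
  qed
qed

text \<open>For fixed moduli \<open>r\<close> and \<open>s\<close> the inequality is affine in the inner product \<open>c\<close> of the two points, and the
sign of the coefficient \<open>f_factor M r - 12 * M^2\<close> of \<open>c\<close> on the right makes $c = rs$ the worst case. There the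
points are aligned and the radial inequality applies.\<close>

lemma F_trunc_tangent:
  fixes z w :: complex
  assumes M: "M > 0"
  shows "F_trunc M w \<le> F_trunc M z + f_trunc M z \<bullet> (w - z) + 6 * M\<^sup>2 * (cmod (w - z))\<^sup>2"
proof -
  define r s c where "r = cmod z" and "s = cmod w" and "c = z \<bullet> w"
  have rs: "0 \<le> r" "0 \<le> s" "c \<le> r * s" by (auto simp: r_def s_def c_def norm_cauchy_schwarz)
  have d: "(cmod (w - z))\<^sup>2 = s\<^sup>2 + r\<^sup>2 - 2 * c"
    by (simp add: r_def s_def c_def power2_norm_eq_inner inner_diff_left inner_diff_right inner_commute)
  have i: "f_trunc M z \<bullet> (w - z) = f_factor M r * (c - r\<^sup>2)"
    by (simp add: f_trunc_eq_factor r_def c_def inner_diff_right power2_norm_eq_inner scaleR_conv_of_real[symmetric])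
      (simp add: algebra_simps)
  have "(12 * M\<^sup>2 - f_factor M r) * c \<le> (12 * M\<^sup>2 - f_factor M r) * (r * s)"
    using f_factor_bounds[OF M rs(1)] rs(3) by (intro mult_left_mono) auto
  moreover have "(if r \<le> M then 4 * r^3 else 12 * M\<^sup>2 * r - 8 * M^3) = f_factor M r * r"
    using M by (auto simp: f_factor_def field_simps power2_eq_square power3_eq_cube)
  ultimately show ?thesis
    using F_trunc_tangent_scalar[OF M rs(1,2)]
    unfolding d i unfolding F_trunc_def r_def[symmetric] s_def[symmetric]
    by (simp only:) (simp add: power2_eq_square algebra_simps)
qed

text \<open>The upper bound makes the potential energy finite on all of $L^2$: truncation leaves only quadratic
growth.\<close>

lemma F_trunc_bounds:
  assumes "M > 0" shows "0 \<le> F_trunc M z" "F_trunc M z \<le> 6 * M\<^sup>2 * (cmod z)\<^sup>2"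
proof -
  define r where "r = cmod z"
  have r: "r \<ge> 0" by (simp add: r_def)
  have 1: "r^4 \<le> 6 * M\<^sup>2 * r\<^sup>2" if "r \<le> M"
  proof -
    have "r\<^sup>2 * r\<^sup>2 \<le> M\<^sup>2 * r\<^sup>2" using that r by (intro mult_right_mono power_mono) auto
    also have "\<dots> \<le> 6 * M\<^sup>2 * r\<^sup>2" by simp
    finally show ?thesis by (simp add: power2_eq_square power4_eq_xxxx)
  qed
  have 2: "0 \<le> 6 * M\<^sup>2 * r\<^sup>2 - 8 * M^3 * r + 3 * M^4" if "r > M"
  proof -
    have "0 \<le> M\<^sup>2 * (6 * (r - M)\<^sup>2 + 4 * M * (r - M) + M\<^sup>2)" using assms that by simp
    also have "\<dots> = 6 * M\<^sup>2 * r\<^sup>2 - 8 * M^3 * r + 3 * M^4"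
      by (simp add: power2_eq_square power3_eq_cube power4_eq_xxxx algebra_simps)
    finally show ?thesis .
  qed
  have 3: "3 * M^4 \<le> 8 * M^3 * r" if "r > M"
  proof -
    have "3 * M^4 = M^3 * (3 * M)" by (simp add: power3_eq_cube power4_eq_xxxx)
    also have "\<dots> \<le> M^3 * (8 * r)" using assms that by (intro mult_left_mono) auto
    finally show ?thesis by simp
  qed
  show "0 \<le> F_trunc M z" "F_trunc M z \<le> 6 * M\<^sup>2 * (cmod z)\<^sup>2"
    using 1 2 3 r by (auto simp: F_trunc_def r_def[symmetric])
qed

lemma f_trunc_bound: "M > 0 \<Longrightarrow> cmod (f_trunc M z) \<le> 12 * M\<^sup>2 * cmod z"
  using f_factor_bounds[of M "cmod z"] by (auto simp: f_trunc_eq_factor norm_mult intro!: mult_right_mono)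

lemma F_trunc_measurable [measurable]: "F_trunc M \<in> borel_measurable borel"
  unfolding F_trunc_def[abs_def] by measurable

lemma f_trunc_measurable [measurable]: "f_trunc M \<in> borel_measurable borel"
  unfolding f_trunc_def[abs_def] by measurable

section \<open>The space of square-integrable functions\<close>

text \<open>The energy is real-differentiable only, so the real part of the Hermitian product is the inner product
that represents its gradient. On \<open>complex\<close> as a real inner product space, $u \bullet v$ is
$\mathrm{Re}(u\bar v)$.\<close>

definition L2_inner :: "'a measure \<Rightarrow> ('a \<Rightarrow> complex) \<Rightarrow> ('a \<Rightarrow> complex) \<Rightarrow> real" where
  "L2_inner D u v = (LINT x|D. u x \<bullet> v x)"

lemma L2_space_measurable: "u \<in> L2_space D \<Longrightarrow> u \<in> borel_measurable D"
  and L2_space_integrable: "u \<in> L2_space D \<Longrightarrow> integrable D (\<lambda>x. (cmod (u x))\<^sup>2)"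
  by (auto simp: L2_space_def)

lemma L2_space_bounded_by:
  assumes "v \<in> L2_space D" "u \<in> borel_measurable D" "AE x in D. cmod (u x) \<le> C * cmod (v x)"
  shows "u \<in> L2_space D"
proof -
  have "integrable D (\<lambda>x. (cmod (u x))\<^sup>2)"
  proof (rule Bochner_Integration.integrable_bound)
    show "integrable D (\<lambda>x. C\<^sup>2 * (cmod (v x))\<^sup>2)" using assms by (simp add: L2_space_def)
    show "AE x in D. norm ((cmod (u x))\<^sup>2) \<le> norm (C\<^sup>2 * (cmod (v x))\<^sup>2)"
      using assms(3)
    proof eventually_elim
      case (elim x)
      then have "(cmod (u x))\<^sup>2 \<le> (C * cmod (v x))\<^sup>2" by (intro power_mono) auto
      then show ?case by (simp add: power_mult_distrib)
    qed
  qed (use assms in measurable)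
  then show ?thesis using assms by (simp add: L2_space_def)
qed

lemma L2_space_cmult: "u \<in> L2_space D \<Longrightarrow> (\<lambda>x. c * u x) \<in> L2_space D"
  by (rule L2_space_bounded_by[where C = "cmod c"]) (auto simp: norm_mult L2_space_def)

lemma integrable_L2_inner:
  assumes "u \<in> L2_space D" "v \<in> L2_space D"
  shows "integrable D (\<lambda>x. u x \<bullet> v x)"
proof (rule Bochner_Integration.integrable_bound)
  show "integrable D (\<lambda>x. (cmod (u x))\<^sup>2 + (cmod (v x))\<^sup>2)" using assms by (simp add: L2_space_def)
  show "(\<lambda>x. u x \<bullet> v x) \<in> borel_measurable D"
    using assms by (intro borel_measurable_inner) (simp_all add: L2_space_def)
  show "AE x in D. norm (u x \<bullet> v x) \<le> norm ((cmod (u x))\<^sup>2 + (cmod (v x))\<^sup>2)"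
  proof (rule AE_I2)
    fix x
    have "norm (u x \<bullet> v x) \<le> cmod (u x) * cmod (v x)" by (simp add: Cauchy_Schwarz_ineq2)
    also have "\<dots> \<le> (cmod (u x))\<^sup>2 + (cmod (v x))\<^sup>2"
      using sum_squares_bound[of "cmod (u x)" "cmod (v x)"] mult_nonneg_nonneg[of "cmod (u x)" "cmod (v x)"]
      by (simp del: mult_nonneg_nonneg)
    finally show "norm (u x \<bullet> v x) \<le> norm ((cmod (u x))\<^sup>2 + (cmod (v x))\<^sup>2)" by simp
  qed
qed

lemma L2_space_add:
  assumes "u \<in> L2_space D" "v \<in> L2_space D" shows "(\<lambda>x. u x + v x) \<in> L2_space D"
proof -
  have "(cmod (u x + v x))\<^sup>2 = (cmod (u x))\<^sup>2 + 2 * (u x \<bullet> v x) + (cmod (v x))\<^sup>2" for x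
    by (simp add: power2_norm_eq_inner inner_add_left inner_add_right inner_commute)
  then show ?thesis using assms integrable_L2_inner[OF assms] by (auto simp: L2_space_def)
qed

lemma L2_space_lincomb:
  "u \<in> L2_space D \<Longrightarrow> v \<in> L2_space D \<Longrightarrow> (\<lambda>x. c * u x + d * v x) \<in> L2_space D"
  by (intro L2_space_add L2_space_cmult)

lemma L2_space_diff: "u \<in> L2_space D \<Longrightarrow> v \<in> L2_space D \<Longrightarrow> (\<lambda>x. u x - v x) \<in> L2_space D"
  using L2_space_lincomb[of u D v 1 "-1"] by simp

lemma L2_space_zero: "(\<lambda>x. 0) \<in> L2_space D"
  by (simp add: L2_space_def)

lemma L2_space_sum: "(\<And>i. i \<in> A \<Longrightarrow> u i \<in> L2_space D) \<Longrightarrow> (\<lambda>x. \<Sum>i\<in>A. u i x) \<in> L2_space D"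
  by (induction A rule: infinite_finite_induct) (auto intro: L2_space_zero L2_space_add)

lemma L2_norm_nonneg [simp]: "0 \<le> L2_norm D u"
  by (simp add: L2_norm_def)

lemma L2_norm_square: "(L2_norm D u)\<^sup>2 = L2_inner D u u"
  by (simp add: L2_norm_def L2_inner_def power2_norm_eq_inner)

lemma L2_norm_square': "(L2_norm D u)\<^sup>2 = (LINT x|D. (cmod (u x))\<^sup>2)"
  by (simp add: L2_norm_def)

lemma L2_norm_cong_AE:
  assumes "u \<in> borel_measurable D" "v \<in> borel_measurable D" "AE x in D. u x = v x"
  shows "L2_norm D u = L2_norm D v"
proof -
  have "(LINT x|D. (cmod (u x))\<^sup>2) = (LINT x|D. (cmod (v x))\<^sup>2)"
    using assms by (intro integral_cong_AE) auto
  then show ?thesis by (simp add: L2_norm_def)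
qed

lemma L2_inner_cong_AE:
  assumes "u \<in> borel_measurable D" "v \<in> borel_measurable D" "u' \<in> borel_measurable D" "v' \<in> borel_measurable D"
    "AE x in D. u x = u' x" "AE x in D. v x = v' x"
  shows "L2_inner D u v = L2_inner D u' v'"
  unfolding L2_inner_def using assms by (intro integral_cong_AE) auto

lemma L2_inner_commute: "L2_inner D u v = L2_inner D v u"
  by (simp add: L2_inner_def inner_commute)

lemma L2_inner_add_left:
  "u \<in> L2_space D \<Longrightarrow> v \<in> L2_space D \<Longrightarrow> w \<in> L2_space D \<Longrightarrow>
    L2_inner D (\<lambda>x. u x + v x) w = L2_inner D u w + L2_inner D v w"
  by (simp add: L2_inner_def inner_add_left integrable_L2_inner)

lemma L2_inner_diff_left:
  "u \<in> L2_space D \<Longrightarrow> v \<in> L2_space D \<Longrightarrow> w \<in> L2_space D \<Longrightarrow>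
    L2_inner D (\<lambda>x. u x - v x) w = L2_inner D u w - L2_inner D v w"
  by (simp add: L2_inner_def inner_diff_left integrable_L2_inner)

lemma L2_inner_diff_right:
  "u \<in> L2_space D \<Longrightarrow> v \<in> L2_space D \<Longrightarrow> w \<in> L2_space D \<Longrightarrow>
    L2_inner D w (\<lambda>x. u x - v x) = L2_inner D w u - L2_inner D w v"
  by (simp add: L2_inner_def inner_diff_right integrable_L2_inner)

lemma L2_inner_scale_left: "L2_inner D (\<lambda>x. of_real c * u x) w = c * L2_inner D u w"
  by (simp add: L2_inner_def scaleR_conv_of_real[symmetric])

lemma L2_norm_cmult: "L2_norm D (\<lambda>x. c * u x) = cmod c * L2_norm D u"
  by (simp add: L2_norm_def norm_mult power_mult_distrib real_sqrt_mult)

lemma L2_norm_add_square: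
  assumes "u \<in> L2_space D" "v \<in> L2_space D"
  shows "(L2_norm D (\<lambda>x. u x + v x))\<^sup>2 = (L2_norm D u)\<^sup>2 + 2 * L2_inner D u v + (L2_norm D v)\<^sup>2"
proof -
  have "(u x + v x) \<bullet> (u x + v x) = u x \<bullet> u x + 2 * (u x \<bullet> v x) + v x \<bullet> v x" for x
    by (simp add: inner_add_left inner_add_right inner_commute)
  then show ?thesis using assms
    by (simp add: L2_norm_square L2_inner_def integrable_L2_inner)
qed

text \<open>The quadratic $s \mapsto \|u + s v\|^2$ is nonnegative, so its discriminant is nonpositive.\<close>

lemma L2_Cauchy_Schwarz:
  assumes "u \<in> L2_space D" "v \<in> L2_space D"
  shows "\<bar>L2_inner D u v\<bar> \<le> L2_norm D u * L2_norm D v"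
proof -
  define A B r where "A = (L2_norm D u)\<^sup>2" and "B = (L2_norm D v)\<^sup>2" and "r = L2_inner D u v"
  have q: "0 \<le> A + 2 * s * r + s\<^sup>2 * B" for s :: real
  proof -
    have "(L2_norm D (\<lambda>x. u x + of_real s * v x))\<^sup>2 = A + 2 * s * r + s\<^sup>2 * B"
      using L2_norm_add_square[OF assms(1) L2_space_cmult[OF assms(2), of "of_real s"]]
      by (simp add: A_def B_def r_def L2_norm_cmult power_mult_distrib L2_inner_commute[of D u] L2_inner_scale_left)
    then show ?thesis by (metis zero_le_power2)
  qed
  have "r\<^sup>2 \<le> A * B"
  proof (cases "B = 0")
    case True
    have "r = 0"
    proof (rule ccontr)
      assume "r \<noteq> 0"
      then have "2 * (- (A + 1) / (2 * r)) * r = - (A + 1)" by simp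
      \<comment> \<open>A nonconstant affine function takes negative values; here the value is \<open>-1\<close>.\<close>
      then show False using q[of "- (A + 1) / (2 * r)"] True by (simp only:)
    qed
    then show ?thesis using True by simp
  next
    case False
    then have "B > 0" by (simp add: B_def)
    then show ?thesis using q[of "- r / B"] by (simp add: field_simps power2_eq_square)
  qed
  then have "r\<^sup>2 \<le> (L2_norm D u * L2_norm D v)\<^sup>2" by (simp add: A_def B_def power_mult_distrib)
  then have "\<bar>r\<bar>\<^sup>2 \<le> (L2_norm D u * L2_norm D v)\<^sup>2" by simp
  then have "\<bar>r\<bar> \<le> L2_norm D u * L2_norm D v" by (rule power2_le_imp_le) simp
  then show ?thesis by (simp add: r_def)
qed

lemma L2_norm_triangle:
  assumes "u \<in> L2_space D" "v \<in> L2_space D"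
  shows "L2_norm D (\<lambda>x. u x + v x) \<le> L2_norm D u + L2_norm D v"
proof (rule power2_le_imp_le)
  have "L2_inner D u v \<le> L2_norm D u * L2_norm D v" using L2_Cauchy_Schwarz[OF assms] by simp
  then show "(L2_norm D (\<lambda>x. u x + v x))\<^sup>2 \<le> (L2_norm D u + L2_norm D v)\<^sup>2"
    by (simp add: L2_norm_add_square[OF assms] power2_sum)
qed simp

lemma L2_norm_diff_commute: "L2_norm D (\<lambda>x. u x - v x) = L2_norm D (\<lambda>x. v x - u x)"
  by (simp add: L2_norm_def norm_minus_commute)

lemma L2_norm_triangle_diff:
  assumes "u \<in> L2_space D" "v \<in> L2_space D"
  shows "L2_norm D u \<le> L2_norm D v + L2_norm D (\<lambda>x. u x - v x)"
  using L2_norm_triangle[OF assms(2) L2_space_diff[OF assms]] by simp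

lemma L2_norm_sum_le:
  "(\<And>i. i \<in> A \<Longrightarrow> u i \<in> L2_space D) \<Longrightarrow> L2_norm D (\<lambda>x. \<Sum>i\<in>A. u i x) \<le> (\<Sum>i\<in>A. L2_norm D (u i))"
proof (induction A rule: infinite_finite_induct)
  case (insert i A)
  then show ?case
    using L2_norm_triangle[of "u i" D "\<lambda>x. \<Sum>i\<in>A. u i x"] L2_space_sum[of A u D] by force
qed (auto simp: L2_norm_def)

lemma L2_norm_zero_AE:
  assumes "u \<in> L2_space D" "L2_norm D u = 0" shows "AE x in D. u x = 0"
proof -
  have "(LINT x|D. (cmod (u x))\<^sup>2) = 0" using assms by (simp add: L2_norm_def)
  then show ?thesis
    using integral_nonneg_eq_0_iff_AE[OF L2_space_integrable[OF assms(1)]] by simp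
qed

lemma nn_integral_L2_norm:
  assumes "u \<in> L2_space D"
  shows "(\<integral>\<^sup>+x. ennreal ((cmod (u x))\<^sup>2) \<partial>D) = ennreal ((L2_norm D u)\<^sup>2)"
  using assms by (simp add: L2_norm_square' nn_integral_eq_integral L2_space_integrable)

lemma L2_norm_dist_triangle:
  assumes "u \<in> L2_space D" "v \<in> L2_space D" "w \<in> L2_space D"
  shows "L2_norm D (\<lambda>x. u x - w x) \<le> L2_norm D (\<lambda>x. u x - v x) + L2_norm D (\<lambda>x. v x - w x)"
  using L2_norm_triangle[OF L2_space_diff[OF assms(1,2)] L2_space_diff[OF assms(2,3)]] by simp

lemma L2_inner_tendsto:
  fixes u :: "nat \<Rightarrow> 'a \<Rightarrow> complex"
  assumes L2: "\<And>n. u n \<in> L2_space D" "\<And>n. v n \<in> L2_space D" "u' \<in> L2_space D" "v' \<in> L2_space D"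
    and u: "(\<lambda>n. L2_norm D (\<lambda>x. u n x - u' x)) \<longlonglongrightarrow> 0" and v: "(\<lambda>n. L2_norm D (\<lambda>x. v n x - v' x)) \<longlonglongrightarrow> 0"
  shows "(\<lambda>n. L2_inner D (u n) (v n)) \<longlonglongrightarrow> L2_inner D u' v'"
proof (rule LIM_zero_cancel, rule Lim_null_comparison)
  let ?du = "\<lambda>n. L2_norm D (\<lambda>x. u n x - u' x)" and ?dv = "\<lambda>n. L2_norm D (\<lambda>x. v n x - v' x)"
  show "eventually (\<lambda>n. norm (L2_inner D (u n) (v n) - L2_inner D u' v')
      \<le> ?du n * (L2_norm D v' + ?dv n) + L2_norm D u' * ?dv n) sequentially"
  proof (intro always_eventually allI)
    fix n
    have "L2_inner D (u n) (v n) - L2_inner D u' v'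
        = L2_inner D (\<lambda>x. u n x - u' x) (v n) + L2_inner D u' (\<lambda>x. v n x - v' x)"
      using L2 by (simp add: L2_inner_diff_left L2_inner_diff_right)
    moreover have "\<bar>L2_inner D (\<lambda>x. u n x - u' x) (v n)\<bar> \<le> ?du n * L2_norm D (v n)"
      using L2 by (intro L2_Cauchy_Schwarz L2_space_diff)
    moreover have "?du n * L2_norm D (v n) \<le> ?du n * (L2_norm D v' + ?dv n)"
      using L2 by (intro mult_left_mono L2_norm_triangle_diff) auto
    moreover have "\<bar>L2_inner D u' (\<lambda>x. v n x - v' x)\<bar> \<le> L2_norm D u' * ?dv n"
      using L2 by (intro L2_Cauchy_Schwarz L2_space_diff)
    ultimately show "norm (L2_inner D (u n) (v n) - L2_inner D u' v')
      \<le> ?du n * (L2_norm D v' + ?dv n) + L2_norm D u' * ?dv n" by simp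
  qed
  have "(\<lambda>n. ?du n * (L2_norm D v' + ?dv n) + L2_norm D u' * ?dv n) \<longlonglongrightarrow> 0 * (L2_norm D v' + 0) + L2_norm D u' * 0"
    by (intro tendsto_intros u v)
  then show "(\<lambda>n. ?du n * (L2_norm D v' + ?dv n) + L2_norm D u' * ?dv n) \<longlonglongrightarrow> 0" by simp
qed

lemma bounded_in_L2_space:
  assumes "finite_measure D" "u \<in> borel_measurable D" "\<And>x. x \<in> space D \<Longrightarrow> cmod (u x) \<le> C"
  shows "u \<in> L2_space D"
proof -
  interpret finite_measure D by fact
  have "(\<lambda>x. 1::complex) \<in> L2_space D" by (simp add: L2_space_def)
  then show ?thesis by (rule L2_space_bounded_by[where C = C]) (use assms in auto)
qed

text \<open>On a domain of finite measure, uniform approximation implies approximation in $L^2$.\<close>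

lemma L2_norm_le_bound:
  assumes "finite_measure D" "u \<in> borel_measurable D" "\<And>x. x \<in> space D \<Longrightarrow> cmod (u x) \<le> C" "C \<ge> 0"
  shows "L2_norm D u \<le> C * sqrt (measure D (space D))"
proof -
  interpret finite_measure D by fact
  have "u \<in> L2_space D" using assms(1-3) by (rule bounded_in_L2_space)
  then have "(LINT x|D. (cmod (u x))\<^sup>2) \<le> (LINT x|D. C\<^sup>2)"
    using assms by (intro integral_mono L2_space_integrable) (auto intro: power_mono)
  then have "(L2_norm D u)\<^sup>2 \<le> (C * sqrt (measure D (space D)))\<^sup>2"
    by (simp add: L2_norm_square' power_mult_distrib mult.commute)
  then show ?thesis using assms(4) by (intro power2_le_imp_le[of "L2_norm D u"]) auto
qed

lemma L2_dominated_convergence: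
  fixes w :: "nat \<Rightarrow> 'a \<Rightarrow> complex"
  assumes "\<And>n. w n \<in> borel_measurable D" "u \<in> borel_measurable D"
    and "AE x in D. (\<lambda>n. w n x) \<longlonglongrightarrow> u x"
    and "\<And>n. AE x in D. cmod (w n x - u x) \<le> g x" and "integrable D (\<lambda>x. (g x)\<^sup>2)"
  shows "(\<lambda>n. L2_norm D (\<lambda>x. w n x - u x)) \<longlonglongrightarrow> 0"
proof -
  have "(\<lambda>n. LINT x|D. (cmod (w n x - u x))\<^sup>2) \<longlonglongrightarrow> (LINT x|D. (0::real))"
  proof (rule integral_dominated_convergence)
    show "integrable D (\<lambda>x. (g x)\<^sup>2)" by fact
    show "AE x in D. (\<lambda>n. (cmod (w n x - u x))\<^sup>2) \<longlonglongrightarrow> 0"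
      using assms(3)
    proof eventually_elim
      case (elim x)
      then have "(\<lambda>n. (cmod (w n x - u x))\<^sup>2) \<longlonglongrightarrow> (cmod (u x - u x))\<^sup>2" by (intro tendsto_intros)
      then show ?case by simp
    qed
    show "AE x in D. norm ((cmod (w n x - u x))\<^sup>2) \<le> (g x)\<^sup>2" for n
      using assms(4)[of n] by eventually_elim (auto intro: power_mono)
  qed (use assms in simp_all)
  then have "(\<lambda>n. sqrt (LINT x|D. (cmod (w n x - u x))\<^sup>2)) \<longlonglongrightarrow> sqrt 0"
    by (intro tendsto_real_sqrt) simp
  then show ?thesis by (simp add: L2_norm_def)
qed

text \<open>Riesz--Fischer: an absolutely convergent series in $L^2$ converges. The partial sums of the moduli are
bounded in $L^2$, so by monotone convergence the series converges absolutely almost everywhere; Fatou's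
lemma bounds the tails. The quantitative tail is what the gliding-hump argument below consumes.\<close>

lemma L2_complete:
  fixes g :: "nat \<Rightarrow> 'a \<Rightarrow> complex"
  assumes g: "\<And>k. g k \<in> L2_space D" and r: "\<And>k. L2_norm D (g k) \<le> r k" "summable r"
  obtains x where "x \<in> L2_space D"
    "\<And>n. L2_norm D (\<lambda>t. x t - (\<Sum>k<n. g k t)) \<le> (\<Sum>k. r (k + n))"
proof -
  have r0: "r k \<ge> 0" for k using order_trans[OF L2_norm_nonneg r(1)] .
  have [measurable]: "g k \<in> borel_measurable D" for k using g by (simp add: L2_space_def)
  define s where "s = (\<lambda>n t. \<Sum>k<n. g k t)"
  define h where "h = (\<lambda>m t. \<Sum>k<m. cmod (g k t))"
  have h_meas [measurable]: "h m \<in> borel_measurable D" for m unfolding h_def by measurable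
  have g': "(\<lambda>t. complex_of_real (cmod (g k t))) \<in> L2_space D" for k
    using g[of k] by (simp add: L2_space_def)
  have h_bound: "(\<integral>\<^sup>+t. ennreal ((h m t)\<^sup>2) \<partial>D) \<le> ennreal ((suminf r)\<^sup>2)" for m
  proof -
    have "L2_norm D (\<lambda>t. \<Sum>k<m. complex_of_real (cmod (g k t))) \<le> (\<Sum>k<m. L2_norm D (\<lambda>t. complex_of_real (cmod (g k t))))"
      by (rule L2_norm_sum_le) (rule g')
    also have "\<dots> = (\<Sum>k<m. L2_norm D (g k))" by (simp add: L2_norm_def)
    also have "\<dots> \<le> (\<Sum>k<m. r k)" by (intro sum_mono r)
    also have "\<dots> \<le> suminf r" using r(2) r0 by (intro sum_le_suminf) auto
    finally have "(L2_norm D (\<lambda>t. \<Sum>k<m. complex_of_real (cmod (g k t))))\<^sup>2 \<le> (suminf r)\<^sup>2"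
      by (intro power_mono) auto
    moreover have "(\<integral>\<^sup>+t. ennreal ((cmod (\<Sum>k<m. complex_of_real (cmod (g k t))))\<^sup>2) \<partial>D)
        = ennreal ((L2_norm D (\<lambda>t. \<Sum>k<m. complex_of_real (cmod (g k t))))\<^sup>2)"
      by (intro nn_integral_L2_norm L2_space_sum g')
    ultimately show ?thesis by (simp add: h_def ennreal_leI flip: of_real_sum)
  qed
  have "(\<integral>\<^sup>+t. (SUP m. ennreal ((h m t)\<^sup>2)) \<partial>D) = (SUP m. \<integral>\<^sup>+t. ennreal ((h m t)\<^sup>2) \<partial>D)"
  proof (intro nn_integral_monotone_convergence_SUP)
    have "h i t \<le> h j t" "0 \<le> h i t" if "i \<le> j" for i j t
      unfolding h_def using that by (auto intro!: sum_mono2 sum_nonneg)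
    then show "incseq (\<lambda>m t. ennreal ((h m t)\<^sup>2))"
      by (auto simp: incseq_def le_fun_def intro!: ennreal_leI power_mono)
  qed simp
  also have "\<dots> \<le> ennreal ((suminf r)\<^sup>2)" by (intro SUP_least h_bound)
  finally have "(\<integral>\<^sup>+t. (SUP m. ennreal ((h m t)\<^sup>2)) \<partial>D) \<noteq> \<infinity>" by (auto simp: top_unique)
  then have "AE t in D. (SUP m. ennreal ((h m t)\<^sup>2)) \<noteq> \<infinity>"
    by (intro nn_integral_noteq_infinite) auto
  then have summ: "AE t in D. summable (\<lambda>k. g k t)"
  proof eventually_elim
    case (elim t)
    then obtain B where B: "(SUP m. ennreal ((h m t)\<^sup>2)) = ennreal B" "B \<ge> 0"
      by (cases "SUP m. ennreal ((h m t)\<^sup>2)") auto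
    have "h m t \<le> B + 1" for m
    proof -
      have "ennreal ((h m t)\<^sup>2) \<le> ennreal B" unfolding B(1)[symmetric] by (intro SUP_upper) auto
      then have "(h m t)\<^sup>2 \<le> B" using B(2) by (simp add: ennreal_le_iff)
      also have "B \<le> (B + 1)\<^sup>2" using B(2) by (simp add: power2_eq_square algebra_simps)
      finally show ?thesis using B(2) by (intro power2_le_imp_le[of "h m t"]) auto
    qed
    then have "summable (\<lambda>k. cmod (g k t))"
      by (intro summableI_nonneg_bounded[where x = "B + 1"]) (auto simp: h_def)
    then show ?case by (rule summable_norm_cancel)
  qed
  define x where "x = (\<lambda>t. \<Sum>k. g k t)"
  have [measurable]: "x \<in> borel_measurable D" unfolding x_def by measurable
  have [measurable]: "s n \<in> borel_measurable D" for n unfolding s_def by measurable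
  have s_L2: "s n \<in> L2_space D" for n unfolding s_def by (intro L2_space_sum g)
  have main: "(\<lambda>t. x t - s n t) \<in> L2_space D \<and> L2_norm D (\<lambda>t. x t - s n t) \<le> (\<Sum>k. r (k + n))" for n
  proof -
    define T where "T = (\<Sum>k. r (k + n))"
    have T0: "T \<ge> 0" unfolding T_def using r0 r(2) by (intro suminf_nonneg) (auto simp: summable_iff_shift)
    have tail: "(\<integral>\<^sup>+t. ennreal ((cmod (s (m + n) t - s n t))\<^sup>2) \<partial>D) \<le> ennreal (T\<^sup>2)" for m
    proof -
      have eq: "s (m + n) t - s n t = (\<Sum>k<m. g (k + n) t)" for t
        unfolding s_def using sum.shift_bounds_nat_ivl[of "\<lambda>k. g k t" 0 n m]
          sum_diff_nat_ivl[of 0 n "m + n" "\<lambda>k. g k t"]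
        by (simp add: atLeast0LessThan)
      have "L2_norm D (\<lambda>t. s (m + n) t - s n t) \<le> (\<Sum>k<m. L2_norm D (g (k + n)))"
        unfolding eq by (intro L2_norm_sum_le g)
      also have "\<dots> \<le> (\<Sum>k<m. r (k + n))" by (intro sum_mono r)
      also have "\<dots> \<le> T" unfolding T_def using r(2) r0 by (intro sum_le_suminf) (auto simp: summable_iff_shift)
      finally have "(L2_norm D (\<lambda>t. s (m + n) t - s n t))\<^sup>2 \<le> T\<^sup>2" by (intro power_mono) auto
      then show ?thesis by (simp add: nn_integral_L2_norm L2_space_diff s_L2 ennreal_leI)
    qed
    have "(\<integral>\<^sup>+t. ennreal ((cmod (x t - s n t))\<^sup>2) \<partial>D)
        = (\<integral>\<^sup>+t. liminf (\<lambda>m. ennreal ((cmod (s (m + n) t - s n t))\<^sup>2)) \<partial>D)"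
    proof (rule nn_integral_cong_AE)
      show "AE t in D. ennreal ((cmod (x t - s n t))\<^sup>2) = liminf (\<lambda>m. ennreal ((cmod (s (m + n) t - s n t))\<^sup>2))"
        using summ
      proof eventually_elim
        case (elim t)
        have "(\<lambda>m. s m t) \<longlonglongrightarrow> x t" unfolding s_def x_def by (rule summable_LIMSEQ[OF elim])
        then have "(\<lambda>m. s (m + n) t) \<longlonglongrightarrow> x t" by (rule LIMSEQ_ignore_initial_segment)
        then have "(\<lambda>m. ennreal ((cmod (s (m + n) t - s n t))\<^sup>2)) \<longlonglongrightarrow> ennreal ((cmod (x t - s n t))\<^sup>2)"
          by (intro tendsto_intros tendsto_ennrealI)
        then show ?case by (intro lim_imp_Liminf[symmetric]) auto
      qed
    qed
    also have "\<dots> \<le> liminf (\<lambda>m. \<integral>\<^sup>+t. ennreal ((cmod (s (m + n) t - s n t))\<^sup>2) \<partial>D)"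
      by (intro nn_integral_liminf) measurable
    also have "\<dots> \<le> liminf (\<lambda>m. ennreal (T\<^sup>2))"
      by (intro Liminf_mono always_eventually allI tail)
    also have "\<dots> = ennreal (T\<^sup>2)" by (simp add: Liminf_const)
    finally have le: "(\<integral>\<^sup>+t. ennreal ((cmod (x t - s n t))\<^sup>2) \<partial>D) \<le> ennreal (T\<^sup>2)" .
    have "integrable D (\<lambda>t. (cmod (x t - s n t))\<^sup>2)"
      using le by (intro integrableI_nonneg) (auto simp: less_top[symmetric] top_unique)
    then have L2: "(\<lambda>t. x t - s n t) \<in> L2_space D" by (simp add: L2_space_def)
    have "(L2_norm D (\<lambda>t. x t - s n t))\<^sup>2 \<le> T\<^sup>2"
      using le unfolding nn_integral_L2_norm[OF L2] by (simp add: ennreal_le_iff)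
    then have "L2_norm D (\<lambda>t. x t - s n t) \<le> T" using T0 by (rule power2_le_imp_le)
    with L2 show ?thesis by (simp add: T_def)
  qed
  show ?thesis
  proof (rule that)
    show "x \<in> L2_space D" using main[of 0] by (simp add: s_def)
    show "L2_norm D (\<lambda>t. x t - (\<Sum>k<n. g k t)) \<le> (\<Sum>k. r (k + n))" for n
      using main[of n] by (simp add: s_def)
  qed
qed

section \<open>Bounded operators and the uniform boundedness principle\<close>

text \<open>Linearity is required only almost everywhere because elements of $L^2$ are represented by functions; by
boundedness such an operator also respects almost-everywhere equality (\<open>bounded_op_cong_AE\<close>).\<close>

definition bounded_op :: "'a measure \<Rightarrow> (('a \<Rightarrow> complex) \<Rightarrow> 'a \<Rightarrow> complex) \<Rightarrow> bool" where
  "bounded_op D T \<longleftrightarrow>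
     (\<forall>u\<in>L2_space D. T u \<in> L2_space D) \<and>
     (\<forall>u\<in>L2_space D. \<forall>v\<in>L2_space D. \<forall>c d. AE x in D. T (\<lambda>y. c * u y + d * v y) x = c * T u x + d * T v x) \<and>
     (\<exists>C. \<forall>u\<in>L2_space D. L2_norm D (T u) \<le> C * L2_norm D u)"

lemma C0_semigroup_bounded_op: "C0_semigroup D S \<Longrightarrow> t \<ge> 0 \<Longrightarrow> bounded_op D (S t)"
  by (auto simp: C0_semigroup_def bounded_op_def)

lemma bounded_op_L2: "bounded_op D T \<Longrightarrow> u \<in> L2_space D \<Longrightarrow> T u \<in> L2_space D"
  by (simp add: bounded_op_def)

lemma bounded_op_measurable: "bounded_op D T \<Longrightarrow> u \<in> L2_space D \<Longrightarrow> T u \<in> borel_measurable D"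
  by (auto simp: bounded_op_def L2_space_def)

lemma bounded_op_lincomb:
  "bounded_op D T \<Longrightarrow> u \<in> L2_space D \<Longrightarrow> v \<in> L2_space D \<Longrightarrow>
    AE x in D. T (\<lambda>y. c * u y + d * v y) x = c * T u x + d * T v x"
  by (simp add: bounded_op_def)

lemma bounded_op_bound:
  assumes "bounded_op D T"
  obtains C where "C > 0" "\<And>u. u \<in> L2_space D \<Longrightarrow> L2_norm D (T u) \<le> C * L2_norm D u"
proof -
  obtain C where C: "\<And>u. u \<in> L2_space D \<Longrightarrow> L2_norm D (T u) \<le> C * L2_norm D u"
    using assms unfolding bounded_op_def by blast
  have "L2_norm D (T u) \<le> max C 1 * L2_norm D u" if "u \<in> L2_space D" for u
    using C[OF that] by (rule order_trans) (intro mult_right_mono, auto)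
  then show thesis by (intro that[of "max C 1"]) auto
qed

lemma bounded_op_diff:
  "bounded_op D T \<Longrightarrow> u \<in> L2_space D \<Longrightarrow> v \<in> L2_space D \<Longrightarrow>
    AE x in D. T (\<lambda>y. u y - v y) x = T u x - T v x"
  using bounded_op_lincomb[of D T u v 1 "-1"] by simp

lemma bounded_op_cmult:
  "bounded_op D T \<Longrightarrow> u \<in> L2_space D \<Longrightarrow> AE x in D. T (\<lambda>y. c * u y) x = c * T u x"
  using bounded_op_lincomb[of D T u u c 0] by simp

lemma bounded_op_L2_norm_diff:
  assumes "bounded_op D T" "u \<in> L2_space D" "v \<in> L2_space D"
  shows "L2_norm D (\<lambda>x. T u x - T v x) = L2_norm D (T (\<lambda>y. u y - v y))"
  using AE_symmetric[OF bounded_op_diff[OF assms]] bounded_op_measurable[OF assms(1) assms(2)]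
    bounded_op_measurable[OF assms(1) assms(3)] bounded_op_measurable[OF assms(1) L2_space_diff[OF assms(2,3)]]
  by (intro L2_norm_cong_AE) auto

text \<open>The difference of the arguments has norm zero, hence so does its image.\<close>

lemma bounded_op_cong_AE:
  assumes T: "bounded_op D T" and uv: "u \<in> L2_space D" "v \<in> L2_space D" "AE x in D. u x = v x"
  shows "AE x in D. T u x = T v x"
proof -
  obtain C where C: "\<And>u. u \<in> L2_space D \<Longrightarrow> L2_norm D (T u) \<le> C * L2_norm D u"
    using bounded_op_bound[OF T] by blast
  have "L2_norm D (\<lambda>y. u y - v y) = L2_norm D (\<lambda>y. 0)"
    using uv L2_space_diff[OF uv(1,2)] by (intro L2_norm_cong_AE) (auto simp: L2_space_def)
  then have 0: "L2_norm D (\<lambda>y. u y - v y) = 0" by (simp add: L2_norm_def)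
  have "L2_norm D (\<lambda>x. T u x - T v x) \<le> C * 0"
    unfolding bounded_op_L2_norm_diff[OF T uv(1,2)] using C[OF L2_space_diff[OF uv(1,2)]] 0 by simp
  then have "L2_norm D (\<lambda>x. T u x - T v x) = 0" using L2_norm_nonneg[of D "\<lambda>x. T u x - T v x"] by simp
  then have "AE x in D. T u x - T v x = 0"
    using L2_norm_zero_AE[OF L2_space_diff[OF bounded_op_L2[OF T uv(1)] bounded_op_L2[OF T uv(2)]]] by blast
  then show ?thesis by simp
qed

lemma bounded_op_tendsto:
  assumes T: "bounded_op D T" and L2: "\<And>n. u n \<in> L2_space D" "u' \<in> L2_space D"
    and u: "(\<lambda>n. L2_norm D (\<lambda>x. u n x - u' x)) \<longlonglongrightarrow> 0"
  shows "(\<lambda>n. L2_norm D (\<lambda>x. T (u n) x - T u' x)) \<longlonglongrightarrow> 0"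
proof -
  obtain C where C: "\<And>u. u \<in> L2_space D \<Longrightarrow> L2_norm D (T u) \<le> C * L2_norm D u"
    using bounded_op_bound[OF T] by blast
  show ?thesis
  proof (rule Lim_null_comparison)
  show "eventually (\<lambda>n. norm (L2_norm D (\<lambda>x. T (u n) x - T u' x)) \<le> C * L2_norm D (\<lambda>x. u n x - u' x)) sequentially"
    using C[OF L2_space_diff[OF L2]] by (simp add: bounded_op_L2_norm_diff[OF T L2])
  show "(\<lambda>n. C * L2_norm D (\<lambda>x. u n x - u' x)) \<longlonglongrightarrow> 0"
    using tendsto_mult_left[OF u, of C] by simp
  qed
qed

text \<open>\<open>N\<close> is the operator norm, and \<open>y\<close> attains it up to the factor $3/4$. Any factor strictly between $1/2$
and $1$ would serve in the next proof.\<close>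

lemma bounded_op_norming_vector:
  assumes T: "bounded_op D T"
  obtains N y where "N \<ge> 0" "\<And>u. u \<in> L2_space D \<Longrightarrow> L2_norm D (T u) \<le> N * L2_norm D u"
    "y \<in> L2_space D" "L2_norm D y \<le> 1" "L2_norm D (T y) \<ge> 3/4 * N"
proof -
  obtain C where C: "C > 0" "\<And>u. u \<in> L2_space D \<Longrightarrow> L2_norm D (T u) \<le> C * L2_norm D u"
    using bounded_op_bound[OF T] by blast
  define A where "A = {L2_norm D (T u) | u. u \<in> L2_space D \<and> L2_norm D u \<le> 1}"
  define N where "N = Sup A"
  have z: "(\<lambda>x. 0) \<in> L2_space D" "L2_norm D (\<lambda>x. 0) \<le> 1" by (simp_all add: L2_space_zero L2_norm_def)
  have bdd: "bdd_above A"
  proof (rule bdd_aboveI)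
    fix a assume "a \<in> A"
    then obtain u where u: "u \<in> L2_space D" "L2_norm D u \<le> 1" "a = L2_norm D (T u)" by (auto simp: A_def)
    have "a \<le> C * L2_norm D u" using C u by simp
    also have "\<dots> \<le> C * 1" using C u by (intro mult_left_mono) auto
    finally show "a \<le> C" by simp
  qed
  have ne: "A \<noteq> {}" using z by (auto simp: A_def)
  have up: "L2_norm D (T u) \<le> N" if "u \<in> L2_space D" "L2_norm D u \<le> 1" for u
    unfolding N_def using that bdd by (intro cSup_upper) (auto simp: A_def)
  have N0: "N \<ge> 0" using order_trans[OF L2_norm_nonneg up[OF z]] .
  have bound: "L2_norm D (T u) \<le> N * L2_norm D u" if u: "u \<in> L2_space D" for u
  proof (cases "L2_norm D u = 0")
    case True
    then show ?thesis using C(2)[OF u] by simp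
  next
    case False
    define c where "c = L2_norm D u"
    have c: "c > 0" using False by (simp add: c_def less_le)
    let ?w = "\<lambda>x. complex_of_real (1 / c) * u x"
    have w: "?w \<in> L2_space D" using u by (rule L2_space_cmult)
    have "L2_norm D ?w = 1" using c unfolding L2_norm_cmult c_def by (simp add: norm_divide)
    then have "L2_norm D (T ?w) \<le> N" using up[OF w] by simp
    moreover have "L2_norm D (T ?w) = L2_norm D (\<lambda>x. complex_of_real (1 / c) * T u x)"
      using bounded_op_cmult[OF T u, of "complex_of_real (1 / c)"]
        bounded_op_measurable[OF T u] bounded_op_measurable[OF T w]
      by (intro L2_norm_cong_AE) auto
    moreover have "\<dots> = L2_norm D (T u) / c" using c unfolding L2_norm_cmult by (simp add: norm_divide)
    ultimately show ?thesis using c by (simp add: c_def field_simps)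
  qed
  show thesis
  proof (cases "N = 0")
    case True
    then show ?thesis using that[OF N0 bound z] by simp
  next
    case False
    then have "3/4 * N < Sup A" using N0 by (simp add: N_def)
    then obtain a where "a \<in> A" "3/4 * N < a" using less_cSupE[OF _ ne] by blast
    then obtain y where "y \<in> L2_space D" "L2_norm D y \<le> 1" "3/4 * N < L2_norm D (T y)" by (auto simp: A_def)
    then show ?thesis using that[OF N0 bound, of y] by simp
  qed
qed

text \<open>Sokal's elementary form of the gliding-hump argument. The vector \<open>x\<close> is the limit of a walk whose \<open>n\<close>-th
step is $\pm 3^{-n}y_n$ with $y_n$ almost norming for $T_n$. One of the two signs gives the
new position an image under $T_n$ of norm at least $3^{-n}\|T_n y_n\|$, and all later steps
together have length at most $\frac12 3^{-n}$, too short to undo this. As the operator norms are at least $4^n$,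
the images of \<open>x\<close> grow like $(4/3)^n$.\<close>

lemma uniform_boundedness:
  fixes T :: "nat \<Rightarrow> ('a \<Rightarrow> complex) \<Rightarrow> 'a \<Rightarrow> complex"
  assumes T: "\<And>n. bounded_op D (T n)"
    and unb: "\<And>n. \<exists>u\<in>L2_space D. L2_norm D (T n u) > 4 ^ n * L2_norm D u"
  obtains x where "x \<in> L2_space D" "\<And>n. L2_norm D (T n x) \<ge> 1/4 * (4/3) ^ n"
proof -
  have "\<forall>n. \<exists>N y. N \<ge> 0 \<and> (\<forall>u\<in>L2_space D. L2_norm D (T n u) \<le> N * L2_norm D u) \<and>
    y \<in> L2_space D \<and> L2_norm D y \<le> 1 \<and> L2_norm D (T n y) \<ge> 3/4 * N"
    using bounded_op_norming_vector[OF T] by (metis (no_types, lifting))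
  then obtain N y where N: "\<And>n. N n \<ge> 0" "\<And>n u. u \<in> L2_space D \<Longrightarrow> L2_norm D (T n u) \<le> N n * L2_norm D u"
    and y: "\<And>n. y n \<in> L2_space D" "\<And>n. L2_norm D (y n) \<le> 1" "\<And>n. L2_norm D (T n (y n)) \<ge> 3/4 * N n"
    by metis
  have N4: "4 ^ n \<le> N n" for n
  proof -
    obtain u where u: "u \<in> L2_space D" "4 ^ n * L2_norm D u < L2_norm D (T n u)" using unb by blast
    then have "4 ^ n * L2_norm D u < N n * L2_norm D u" using N(2)[OF u(1), of n] by linarith
    then show ?thesis by (simp add: mult_less_cancel_right)
  qed
  define r where "r = (\<lambda>n. (1/3::real) ^ n)"
  define X where "X = rec_nat (\<lambda>_. 0) (\<lambda>n x.
     if L2_norm D (T n (\<lambda>t. 1 * x t + of_real (r n) * y n t)) \<ge> r n * L2_norm D (T n (y n))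
     then (\<lambda>t. 1 * x t + of_real (r n) * y n t) else (\<lambda>t. 1 * x t + (- of_real (r n)) * y n t))"
  define g where "g = (\<lambda>n t. X (Suc n) t - X n t)"
  have X0: "X 0 = (\<lambda>_. 0)" by (simp add: X_def)
  have XS: "X (Suc n) = (if L2_norm D (T n (\<lambda>t. 1 * X n t + of_real (r n) * y n t)) \<ge> r n * L2_norm D (T n (y n))
     then (\<lambda>t. 1 * X n t + of_real (r n) * y n t) else (\<lambda>t. 1 * X n t + (- of_real (r n)) * y n t))" for n
    by (simp add: X_def)
  have X_L2: "X n \<in> L2_space D" for n
  proof (induction n)
    case 0 show ?case by (simp add: X0 L2_space_zero)
  next
    case (Suc n)
    show ?case unfolding XS
      using L2_space_lincomb[OF Suc y(1), of 1 "of_real (r n)" n] L2_space_lincomb[OF Suc y(1), of 1 "- of_real (r n)" n]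
      by (auto simp only: split: if_split)
  qed
  have X_sum: "X n t = (\<Sum>k<n. g k t)" for n t
    by (induction n) (simp_all add: X0 g_def)
  have r0: "r n \<ge> 0" for n by (simp add: r_def)
  have g_cases: "g n = (\<lambda>t. of_real (r n) * y n t) \<or> g n = (\<lambda>t. (- of_real (r n)) * y n t)" for n
    unfolding g_def XS by auto
  have g_L2: "g n \<in> L2_space D" for n using g_cases[of n] L2_space_cmult[OF y(1)] by metis
  have g_norm: "L2_norm D (g n) \<le> r n" for n
  proof -
    have "L2_norm D (g n) = r n * L2_norm D (y n)"
    proof -
      from g_cases[of n] show ?thesis
        by (rule disjE; simp only: L2_norm_cmult) (use r0[of n] in simp_all)
    qed
    also have "\<dots> \<le> r n * 1" using r0 y(2) by (intro mult_left_mono)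
    finally show ?thesis by simp
  qed
  have big: "L2_norm D (T n (X (Suc n))) \<ge> r n * L2_norm D (T n (y n))" for n
  proof (cases "L2_norm D (T n (\<lambda>t. 1 * X n t + of_real (r n) * y n t)) \<ge> r n * L2_norm D (T n (y n))")
    case True
    then show ?thesis unfolding XS by simp
  next
    case False
    \<comment> \<open>If the plus sign fails, the minus sign works, because the two images differ by twice the image of
      the step.\<close>
    let ?p = "\<lambda>t. 1 * X n t + of_real (r n) * y n t" and ?m = "\<lambda>t. 1 * X n t + (- of_real (r n)) * y n t"
    have pm: "?p \<in> L2_space D" "?m \<in> L2_space D" using X_L2 y(1) by (intro L2_space_lincomb; simp)+
    have "AE t in D. T n ?p t - T n ?m t = of_real (2 * r n) * T n (y n) t"
      using bounded_op_lincomb[OF T[of n] X_L2[of n] y(1)[of n], where c = 1 and d = "of_real (r n)"]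
        bounded_op_lincomb[OF T[of n] X_L2[of n] y(1)[of n], where c = 1 and d = "- of_real (r n)"]
      by eventually_elim (simp add: algebra_simps)
    then have "L2_norm D (\<lambda>t. T n ?p t - T n ?m t) = L2_norm D (\<lambda>t. of_real (2 * r n) * T n (y n) t)"
      using bounded_op_measurable[OF T pm(1)] bounded_op_measurable[OF T pm(2)] bounded_op_measurable[OF T y(1)]
      by (intro L2_norm_cong_AE) auto
    also have "\<dots> = 2 * (r n * L2_norm D (T n (y n)))" unfolding L2_norm_cmult using r0[of n] by simp
    finally have "2 * (r n * L2_norm D (T n (y n))) = L2_norm D (\<lambda>t. T n ?p t - T n ?m t)" ..
    also have "\<dots> = L2_norm D (\<lambda>t. T n ?p t + (-1) * T n ?m t)" by simp
    also have "\<dots> \<le> L2_norm D (T n ?p) + L2_norm D (\<lambda>t. (-1) * T n ?m t)"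
      by (rule L2_norm_triangle[OF bounded_op_L2[OF T pm(1)] L2_space_cmult[OF bounded_op_L2[OF T pm(2)]]])
    also have "L2_norm D (\<lambda>t. (-1) * T n ?m t) = L2_norm D (T n ?m)" unfolding L2_norm_cmult by simp
    finally show ?thesis using False unfolding XS by (simp only: if_False)
  qed
  have r_summable: "summable r" unfolding r_def by (intro summable_geometric) simp
  obtain x where x: "x \<in> L2_space D" "\<And>n. L2_norm D (\<lambda>t. x t - (\<Sum>k<n. g k t)) \<le> (\<Sum>k. r (k + n))"
    using L2_complete[OF g_L2 g_norm r_summable] by blast
  have tail: "(\<Sum>k. r (k + Suc n)) = 1/2 * r n" for n
  proof -
    have "(\<lambda>k. (1/3::real) ^ k) sums (3/2)" using geometric_sums[of "1/3::real"] by simp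
    then have "(\<lambda>k. (1/3) ^ Suc n * (1/3::real) ^ k) sums ((1/3) ^ Suc n * (3/2))" by (rule sums_mult)
    then show ?thesis by (simp add: r_def power_add mult_ac sums_iff)
  qed
  show thesis
  proof (rule that[OF x(1)])
    fix n
    have "L2_norm D (T n (X (Suc n))) \<le> L2_norm D (T n x) + L2_norm D (\<lambda>t. T n (X (Suc n)) t - T n x t)"
      by (intro L2_norm_triangle_diff bounded_op_L2[OF T] X_L2 x)
    also have "L2_norm D (\<lambda>t. T n (X (Suc n)) t - T n x t) = L2_norm D (T n (\<lambda>t. X (Suc n) t - x t))"
      by (intro bounded_op_L2_norm_diff T X_L2 x)
    also have "\<dots> \<le> N n * L2_norm D (\<lambda>t. X (Suc n) t - x t)" by (intro N L2_space_diff X_L2 x)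
    also have "L2_norm D (\<lambda>t. X (Suc n) t - x t) = L2_norm D (\<lambda>t. x t - (\<Sum>k<Suc n. g k t))"
      by (subst L2_norm_diff_commute) (simp only: X_sum)
    also have "N n * \<dots> \<le> N n * (1/2 * r n)"
      using x(2)[of "Suc n"] N(1)[of n] unfolding tail by (rule mult_left_mono)
    finally have "L2_norm D (T n (X (Suc n))) \<le> L2_norm D (T n x) + N n * (1/2 * r n)" by simp
    moreover have "r n * (3/4 * N n) \<le> L2_norm D (T n (X (Suc n)))"
      using big[of n] mult_left_mono[OF y(3) r0, of n n] by linarith
    ultimately have "1/4 * (N n * r n) \<le> L2_norm D (T n x)" by (simp add: algebra_simps)
    moreover have "(4/3) ^ n \<le> N n * r n"
      using mult_right_mono[OF N4[of n] r0[of n]] by (simp add: r_def power_divide)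
    ultimately show "1/4 * (4/3) ^ n \<le> L2_norm D (T n x)" by linarith
  qed
qed

section \<open>Eigenvectors of strongly continuous semigroups\<close>

lemma semigroup_step:
  assumes S: "C0_semigroup D S" and "s \<ge> 0" "t \<ge> 0" "u \<in> L2_space D"
  shows "AE x in D. S (s + t) u x = S s (S t u) x"
  using assms by (simp add: C0_semigroup_def)

text \<open>Otherwise some times $s_n$ tending to zero would have operator norms above $4^n$, and the uniform
boundedness principle would produce an \<open>x\<close> with unbounded orbit along them, contradicting
$S(s_n)x \to x$.\<close>

lemma C0_semigroup_locally_bounded:
  assumes S: "C0_semigroup D S"
  obtains \<delta> K where "\<delta> > 0" "K > 0"
    "\<And>s u. 0 < s \<Longrightarrow> s \<le> \<delta> \<Longrightarrow> u \<in> L2_space D \<Longrightarrow> L2_norm D (S s u) \<le> K * L2_norm D u"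
proof (rule ccontr)
  assume neg: "\<not> thesis"
  have "\<exists>s. 0 < s \<and> s \<le> 1 / real (Suc n) \<and> (\<exists>u\<in>L2_space D. L2_norm D (S s u) > 4 ^ n * L2_norm D u)" for n
    using that[of "1 / real (Suc n)" "4 ^ n"] neg by force
  then obtain s where s: "\<And>n. 0 < s n" "\<And>n. s n \<le> 1 / real (Suc n)"
    "\<And>n. \<exists>u\<in>L2_space D. L2_norm D (S (s n) u) > 4 ^ n * L2_norm D u"
    by metis
  have op: "bounded_op D (S (s n))" for n using C0_semigroup_bounded_op[OF S] s(1)[of n] by simp
  obtain x where x: "x \<in> L2_space D" "\<And>n. L2_norm D (S (s n) x) \<ge> 1/4 * (4/3) ^ n"
    using uniform_boundedness[of D "\<lambda>n. S (s n)", OF op s(3)] by blast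
  have "s \<longlonglongrightarrow> 0"
  proof (rule tendsto_sandwich[of "\<lambda>_. 0" s sequentially "\<lambda>n. 1 / real (Suc n)"])
    show "(\<lambda>n. 1 / real (Suc n)) \<longlonglongrightarrow> 0" by (rule LIMSEQ_Suc[OF lim_1_over_n])
  qed (use s in \<open>auto simp: less_imp_le\<close>)
  then have "filterlim s (at_right 0) sequentially"
    using s(1) by (intro tendsto_imp_filterlim_at_right) auto
  moreover have "((\<lambda>t. L2_norm D (\<lambda>y. S t x y - x y)) \<longlongrightarrow> 0) (at_right 0)"
    using S x(1) by (simp add: C0_semigroup_def)
  ultimately have "(\<lambda>n. L2_norm D (\<lambda>y. S (s n) x y - x y)) \<longlonglongrightarrow> 0"
    by (rule filterlim_compose[rotated])
  then have "eventually (\<lambda>n. L2_norm D (\<lambda>y. S (s n) x y - x y) < 1) sequentially"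
    by (rule order_tendstoD) simp
  moreover have "filterlim (\<lambda>n. (4/3::real) ^ n) at_top sequentially"
    using filterlim_realpow_sequentially_gt1[of "4/3::real"]
    by (intro filterlim_at_infinity_imp_filterlim_at_top) auto
  then have "eventually (\<lambda>n. (4/3::real) ^ n \<ge> 4 * (L2_norm D x + 2)) sequentially"
    by (simp add: filterlim_at_top)
  ultimately have "eventually (\<lambda>n::nat. False) sequentially"
  proof eventually_elim
    case (elim n)
    have "L2_norm D x + 2 \<le> 1/4 * (4/3) ^ n" using elim(2) by simp
    also have "\<dots> \<le> L2_norm D (S (s n) x)" by (rule x(2))
    also have "\<dots> \<le> L2_norm D x + L2_norm D (\<lambda>y. S (s n) x y - x y)"
      by (intro L2_norm_triangle_diff bounded_op_L2[OF op] x)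
    also have "\<dots> < L2_norm D x + 1" using elim(1) by simp
    finally show ?case by simp
  qed
  then show False by simp
qed

text \<open>With $h = t/N$ and $\mu = e^{-lh}$, the telescoping identity
$S(h)^N e - \mu^N e = \sum_k \mu^{N-1-k} S(kh)(S(h)e - \mu e)$ bounds the error at time \<open>t\<close> by
$N K \|S(h)e - \mu e\|$. That \<open>e\<close> is an eigenvector of the generator makes the last norm $o(h)$, so the
error vanishes as $N \to \infty$. This route uses one-sided difference quotients only.\<close>

lemma C0_semigroup_eigenvector_small_time:
  assumes S: "C0_semigroup D S" and gen: "(e, \<lambda>x. - of_real l * e x) \<in> generator D S" and l: "l \<ge> 0"
    and K: "K \<ge> 1" "\<And>s u. 0 < s \<Longrightarrow> s \<le> t \<Longrightarrow> u \<in> L2_space D \<Longrightarrow> L2_norm D (S s u) \<le> K * L2_norm D u"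
    and t: "t > 0"
  shows "AE x in D. S t e x = of_real (exp (- l * t)) * e x"
proof -
  have e: "e \<in> L2_space D" using gen by (simp add: generator_def)
  have op: "bounded_op D (S s)" if "s \<ge> 0" for s using C0_semigroup_bounded_op[OF S that] .
  have Se: "S s u \<in> L2_space D" if "s \<ge> 0" "u \<in> L2_space D" for s u using bounded_op_L2[OF op[OF that(1)] that(2)] .
  \<comment> \<open>The bound \<open>K \<ge> 1\<close> extends the hypothesis to time zero, which occurs in the telescoping sum.\<close>
  have K': "L2_norm D (S s u) \<le> K * L2_norm D u" if "0 \<le> s" "s \<le> t" "u \<in> L2_space D" for s u
  proof (cases "s = 0")
    case True
    have "L2_norm D (S 0 u) = L2_norm D u"
      using S that Se[of 0 u] by (intro L2_norm_cong_AE) (auto simp: C0_semigroup_def L2_space_def)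
    also have "\<dots> \<le> K * L2_norm D u" using K(1) mult_right_mono[of 1 K "L2_norm D u"] by simp
    finally show ?thesis using True by simp
  qed (use K(2) that in simp)
  define \<mu> where "\<mu> = (\<lambda>h. exp (- l * h))"
  define r where "r = (\<lambda>h. L2_norm D (\<lambda>x. S h e x - of_real (\<mu> h) * e x))"
  define q where "q = (\<lambda>h. L2_norm D (\<lambda>x. (S h e x - e x) / of_real h - (- of_real l * e x)))"
  define p where "p = (\<lambda>h. q h + \<bar>(exp (- l * h) - 1) / h - (- l)\<bar> * L2_norm D e)"
  have q_lim: "(q \<longlongrightarrow> 0) (at_right 0)" using gen by (simp add: generator_def q_def)
  have "((\<lambda>h. exp (- l * h)) has_real_derivative (- l)) (at 0)"
    by (auto intro!: derivative_eq_intros)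
  then have "((\<lambda>h. (exp (- l * (0 + h)) - exp (- l * 0)) / h) \<longlongrightarrow> - l) (at 0)"
    unfolding DERIV_def .
  then have "((\<lambda>h. (exp (- l * h) - 1) / h) \<longlongrightarrow> - l) (at 0)" by simp
  then have "((\<lambda>h. (exp (- l * h) - 1) / h) \<longlongrightarrow> - l) (at_right 0)"
    by (rule tendsto_mono[OF at_le[OF subset_UNIV]])
  then have "((\<lambda>h. (exp (- l * h) - 1) / h - (- l)) \<longlongrightarrow> 0) (at_right 0)"
    by (rule LIM_zero)
  then have p_lim: "(p \<longlongrightarrow> 0) (at_right 0)"
    unfolding p_def by (intro tendsto_add_zero q_lim tendsto_mult_left_zero tendsto_rabs_zero)
  have r_le: "r h \<le> h * p h" if h: "h > 0" for h
  proof -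
    define c where "c = (exp (- l * h) - 1) / h - (- l)"
    let ?f = "\<lambda>x. (S h e x - e x) / of_real h - (- of_real l * e x)"
    have f: "?f \<in> L2_space D"
      using L2_space_diff[OF L2_space_cmult[OF L2_space_diff[OF Se[of h e] e], of "1 / of_real h"] L2_space_cmult[OF e, of "- of_real l"]] h e
      by simp
    have eq: "S h e x - of_real (\<mu> h) * e x = of_real h * (?f x + (- of_real c) * e x)" for x
    proof -
      have "h * c = exp (- l * h) - 1 + h * l" using h by (simp add: c_def field_simps)
      then have c': "complex_of_real h * of_real c = of_real (exp (- l * h)) - 1 + of_real h * of_real l"
        by (metis of_real_1 of_real_add of_real_diff of_real_mult)
      have "of_real h * ((S h e x - e x) / of_real h) = S h e x - e x" using h by simp
      moreover have "of_real h * (?f x + (- of_real c) * e x) = of_real h * ((S h e x - e x) / of_real h)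
          + of_real h * of_real l * e x - (of_real h * of_real c) * e x"
        by (simp only: ring_distribs mult_minus_left mult_minus_right diff_conv_add_uminus minus_minus mult.assoc)
      ultimately have "of_real h * (?f x + (- of_real c) * e x)
          = S h e x - e x + of_real h * of_real l * e x - (of_real h * of_real c) * e x" by simp
      then show ?thesis unfolding c' \<mu>_def by (simp only: ring_distribs) simp
    qed
    have "r h = h * L2_norm D (\<lambda>x. ?f x + (- of_real c) * e x)"
      unfolding r_def eq L2_norm_cmult using h by simp
    also have "\<dots> \<le> h * (L2_norm D ?f + L2_norm D (\<lambda>x. (- of_real c) * e x))"
      using h by (intro mult_left_mono L2_norm_triangle f L2_space_cmult e) auto
    also have "\<dots> = h * p h"
      unfolding L2_norm_cmult p_def q_def c_def[symmetric] by (simp only: norm_minus_cancel norm_of_real)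
    finally show ?thesis .
  qed
  have steps: "L2_norm D (\<lambda>x. S (real n * h) e x - of_real (\<mu> h ^ n) * e x) \<le> real n * (K * r h)"
    if h: "h > 0" and n: "real n * h \<le> t" for n h
    using n
  proof (induction n)
    case 0
    have "L2_norm D (\<lambda>x. S 0 e x - e x) = L2_norm D (\<lambda>x. 0)"
      using S e by (intro L2_norm_cong_AE L2_space_measurable L2_space_diff Se L2_space_zero) (auto simp: C0_semigroup_def)
    then show ?case by (simp add: L2_norm_def)
  next
    case (Suc n)
    let ?T = "S (real n * h)"
    have nh: "0 \<le> real n * h" "real n * h \<le> t" using h Suc.prems by (auto simp: algebra_simps)
    have \<mu>: "0 \<le> \<mu> h" "\<mu> h \<le> 1" using h l by (auto simp: \<mu>_def)
    have She: "S h e \<in> L2_space D" using Se h e by simp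
    have \<mu>e: "(\<lambda>x. of_real (\<mu> h) * e x) \<in> L2_space D" by (rule L2_space_cmult[OF e])
    let ?A = "\<lambda>x. ?T (S h e) x - ?T (\<lambda>x. of_real (\<mu> h) * e x) x"
    let ?B = "\<lambda>x. of_real (\<mu> h) * (?T e x - of_real (\<mu> h ^ n) * e x)"
    have A: "?A \<in> L2_space D" by (intro L2_space_diff Se nh She \<mu>e)
    have B: "?B \<in> L2_space D" by (intro L2_space_diff L2_space_cmult Se nh e)
    have "AE x in D. S (real (Suc n) * h) e x - of_real (\<mu> h ^ Suc n) * e x = ?A x + ?B x"
      using semigroup_step[OF S nh(1) less_imp_le[OF h] e] bounded_op_cmult[OF op[OF nh(1)] e, of "of_real (\<mu> h)"]
    proof eventually_elim
      case (elim x)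
      have "real (Suc n) * h = real n * h + h" by (simp add: algebra_simps)
      then show ?case using elim by (simp add: algebra_simps)
    qed
    then have "L2_norm D (\<lambda>x. S (real (Suc n) * h) e x - of_real (\<mu> h ^ Suc n) * e x) = L2_norm D (\<lambda>x. ?A x + ?B x)"
      using A B L2_space_diff[OF Se[of "real (Suc n) * h" e] L2_space_cmult[OF e, of "of_real (\<mu> h ^ Suc n)"]] h e
      by (intro L2_norm_cong_AE L2_space_measurable L2_space_add) auto
    also have "\<dots> \<le> L2_norm D ?A + L2_norm D ?B" by (rule L2_norm_triangle[OF A B])
    also have "L2_norm D ?A = L2_norm D (?T (\<lambda>x. S h e x - of_real (\<mu> h) * e x))"
      by (rule bounded_op_L2_norm_diff[OF op[OF nh(1)] She \<mu>e])
    also have "\<dots> \<le> K * r h"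
      unfolding r_def by (rule K'[OF nh L2_space_diff[OF She \<mu>e]])
    also have "L2_norm D ?B = \<mu> h * L2_norm D (\<lambda>x. ?T e x - of_real (\<mu> h ^ n) * e x)"
      unfolding L2_norm_cmult using \<mu> by simp
    also have "\<dots> \<le> 1 * (real n * (K * r h))" using \<mu> Suc.IH[OF nh(2)] by (intro mult_mono) auto
    finally show ?case by (simp add: algebra_simps)
  qed
  have bound: "L2_norm D (\<lambda>x. S t e x - of_real (exp (- l * t)) * e x) \<le> K * t * p (t / real (Suc N))" for N
  proof -
    define h where "h = t / real (Suc N)"
    have h: "h > 0" "real (Suc N) * h = t" using t by (auto simp: h_def)
    have "\<mu> h ^ Suc N = exp (- l * t)"
      unfolding \<mu>_def exp_of_nat_mult[symmetric] h(2)[symmetric] by (simp add: mult_ac)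
    then have "L2_norm D (\<lambda>x. S t e x - of_real (exp (- l * t)) * e x) \<le> real (Suc N) * (K * r h)"
      using steps[OF h(1), of "Suc N"] h(2) by (simp del: power_Suc of_nat_Suc)
    also have "\<dots> \<le> real (Suc N) * (K * (h * p h))"
      using K(1) r_le[OF h(1)] by (intro mult_left_mono) auto
    also have "\<dots> = K * (real (Suc N) * h) * p h" by (simp only: mult_ac)
    finally show ?thesis unfolding h(2) unfolding h_def .
  qed
  have "(\<lambda>N. t / real (Suc N)) \<longlonglongrightarrow> 0"
    by (rule LIMSEQ_Suc) (rule lim_const_over_n)
  then have "filterlim (\<lambda>N. t / real (Suc N)) (at_right 0) sequentially"
    using t by (intro tendsto_imp_filterlim_at_right) auto
  then have "(\<lambda>N. p (t / real (Suc N))) \<longlonglongrightarrow> 0" by (rule filterlim_compose[OF p_lim])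
  then have "(\<lambda>N. K * t * p (t / real (Suc N))) \<longlonglongrightarrow> K * t * 0" by (intro tendsto_intros)
  then have "L2_norm D (\<lambda>x. S t e x - of_real (exp (- l * t)) * e x) \<le> K * t * 0"
    by (rule LIMSEQ_le_const) (use bound in blast)
  then have "L2_norm D (\<lambda>x. S t e x - of_real (exp (- l * t)) * e x) = 0"
    by (intro order_antisym) simp_all
  then have "AE x in D. S t e x - of_real (exp (- l * t)) * e x = 0"
    by (rule L2_norm_zero_AE[rotated]) (use t e in \<open>auto intro!: L2_space_diff Se L2_space_cmult\<close>)
  then show ?thesis by simp
qed

text \<open>A large time is a multiple of a small one, for which the uniform bound is available.\<close>

lemma C0_semigroup_eigenvector:
  assumes S: "C0_semigroup D S" and gen: "(e, \<lambda>x. - of_real l * e x) \<in> generator D S"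
    and l: "l \<ge> 0" and t: "t \<ge> 0"
  shows "AE x in D. S t e x = of_real (exp (- l * t)) * e x"
proof -
  have e: "e \<in> L2_space D" using gen by (simp add: generator_def)
  obtain \<delta> K where K: "\<delta> > 0" "K > 0"
    "\<And>s u. 0 < s \<Longrightarrow> s \<le> \<delta> \<Longrightarrow> u \<in> L2_space D \<Longrightarrow> L2_norm D (S s u) \<le> K * L2_norm D u"
    using C0_semigroup_locally_bounded[OF S] by blast
  obtain N where N: "t / \<delta> < real N" using reals_Archimedean2 by blast
  define h where "h = t / real (Suc N)"
  show ?thesis
  proof (cases "t = 0")
    case True
    then show ?thesis using S e by (simp add: C0_semigroup_def)
  next
    case False
    then have t0: "t > 0" using t by simp
    have h: "h > 0" "real (Suc N) * h = t" using t0 by (auto simp: h_def)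
    have "t < real N * \<delta>" using N K(1) by (simp add: field_simps)
    then have "h \<le> \<delta>" using K(1) unfolding h_def by (simp add: field_simps)
    have small: "AE x in D. S h e x = of_real (exp (- l * h)) * e x"
    proof (rule C0_semigroup_eigenvector_small_time[OF S gen l, of "max K 1"])
      fix s u assume "0 < s" "s \<le> h" "u \<in> L2_space D"
      then have "L2_norm D (S s u) \<le> K * L2_norm D u" using K(3) \<open>h \<le> \<delta>\<close> by simp
      also have "\<dots> \<le> max K 1 * L2_norm D u" by (intro mult_right_mono) auto
      finally show "L2_norm D (S s u) \<le> max K 1 * L2_norm D u" .
    qed (use h in auto)
    have "AE x in D. S (real n * h) e x = of_real (exp (- l * h) ^ n) * e x" for n
    proof (induction n)
      case 0
      then show ?case using S e by (simp add: C0_semigroup_def)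
    next
      case (Suc n)
      have nh: "0 \<le> real n * h" using h by simp
      have op: "bounded_op D (S (real n * h))" using C0_semigroup_bounded_op[OF S nh] .
      have She: "S h e \<in> L2_space D" using bounded_op_L2[OF C0_semigroup_bounded_op[OF S] e] h by simp
      show ?case
        using semigroup_step[OF S nh less_imp_le[OF h(1)] e] Suc.IH
          bounded_op_cong_AE[OF op She L2_space_cmult[OF e] small]
          bounded_op_cmult[OF op e, of "of_real (exp (- l * h))"]
      proof eventually_elim
        case (elim x)
        have "real (Suc n) * h = real n * h + h" by (simp add: algebra_simps)
        then show ?case using elim by simp
      qed
    qed
    from this[of "Suc N"] show ?thesis
      unfolding h(2) exp_of_nat_mult[symmetric] by (simp add: h(2)[symmetric] mult_ac del: of_nat_Suc)
  qed
qed

section \<open>Fourier modes\<close>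

definition mode :: "real ^ 'd \<Rightarrow> real ^ 'd \<Rightarrow> complex" where
  "mode \<xi> x = cis (\<xi> \<bullet> x)"

text \<open>The frequencies whose exponentials have the period of the box in every coordinate direction.\<close>

definition dual_lattice :: "real ^ 'd \<Rightarrow> real ^ 'd \<Rightarrow> (real ^ 'd) set" where
  "dual_lattice a b = {\<xi>. \<forall>i. \<exists>m::int. \<xi> $ i * (b $ i - a $ i) = 2 * pi * of_int m}"

lemma norm_mode [simp]: "cmod (mode \<xi> x) = 1"
  by (simp add: mode_def)

lemma mode_0 [simp]: "mode 0 x = 1"
  by (simp add: mode_def)

lemma mode_add: "mode (\<xi> + \<eta>) x = mode \<xi> x * mode \<eta> x"
  by (simp add: mode_def cis_mult inner_add_left)

lemma cnj_mode: "cnj (mode \<xi> x) = mode (- \<xi>) x"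
  by (simp add: mode_def cis_cnj)

lemma dual_lattice_0: "0 \<in> dual_lattice a b"
  by (auto simp: dual_lattice_def intro: exI[of _ 0])

lemma dual_lattice_add:
  assumes "\<xi> \<in> dual_lattice a b" "\<eta> \<in> dual_lattice a b" shows "\<xi> + \<eta> \<in> dual_lattice a b"
  unfolding dual_lattice_def
proof (intro CollectI allI)
  fix i
  obtain m k :: int where "\<xi> $ i * (b $ i - a $ i) = 2 * pi * of_int m" "\<eta> $ i * (b $ i - a $ i) = 2 * pi * of_int k"
    using assms unfolding dual_lattice_def by blast
  then show "\<exists>m::int. (\<xi> + \<eta>) $ i * (b $ i - a $ i) = 2 * pi * of_int m"
    by (intro exI[of _ "m + k"]) (simp add: distrib_left distrib_right)
qed

lemma dual_lattice_uminus:
  assumes "\<xi> \<in> dual_lattice a b" shows "- \<xi> \<in> dual_lattice a b"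
  unfolding dual_lattice_def
proof (intro CollectI allI)
  fix i
  obtain m :: int where "\<xi> $ i * (b $ i - a $ i) = 2 * pi * of_int m"
    using assms unfolding dual_lattice_def by blast
  then show "\<exists>m::int. (- \<xi>) $ i * (b $ i - a $ i) = 2 * pi * of_int m"
    by (intro exI[of _ "- m"]) simp
qed

lemma continuous_on_mode: "continuous_on A (mode \<xi>)"
  unfolding mode_def[abs_def] cis_conv_exp by (intro continuous_intros)

lemma mode_translate: "mode \<xi> (x + t *\<^sub>R axis i 1) = mode \<xi> x * cis (t * \<xi> $ i)"
  by (simp add: mode_def cis_mult inner_add_right inner_axis)

lemma cis_has_vector_derivative:
  "((\<lambda>t. cis (t * k)) has_vector_derivative (\<i> * of_real k * cis (t0 * k))) (at t0 within A)"
proof -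
  have "((\<lambda>t. \<i> * of_real (t * k)) has_vector_derivative (\<i> * of_real k)) (at t0 within A)"
    by (auto intro!: derivative_eq_intros simp: has_vector_derivative_def scaleR_conv_of_real mult_ac)
  from field_vector_diff_chain_within[OF this, of exp "exp (\<i> * of_real (t0 * k))"]
  show ?thesis by (simp add: o_def cis_conv_exp has_field_derivative_at_within DERIV_exp)
qed

lemma mode_directional_derivative:
  "((\<lambda>t. c * mode \<xi> (x + t *\<^sub>R axis i 1)) has_vector_derivative (c * (\<i> * of_real (\<xi> $ i)) * mode \<xi> x)) (at 0)"
proof -
  have "((\<lambda>t. (c * mode \<xi> x) * cis (t * \<xi> $ i)) has_vector_derivative ((c * mode \<xi> x) * (\<i> * of_real (\<xi> $ i) * cis (0 * \<xi> $ i)))) (at 0)"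
    by (intro has_vector_derivative_mult_right cis_has_vector_derivative)
  then show ?thesis by (simp add: mode_translate mult_ac)
qed

lemma partial_deriv_mode:
  "partial_deriv i (\<lambda>x. c * mode \<xi> x) = (\<lambda>x. (c * (\<i> * of_real (\<xi> $ i))) * mode \<xi> x)"
  by (rule ext) (simp add: partial_deriv_def vector_derivative_at[OF mode_directional_derivative])

text \<open>A partial derivative of a mode is a multiple of the same mode, which is why the induction must leave the
factor arbitrary.\<close>

lemma Ck_mode: "Ck k (\<lambda>x. c * mode \<xi> x)"
proof (induction k arbitrary: c)
  case 0
  then show ?case by (auto intro!: continuous_intros continuous_on_mode)
next
  case (Suc k)
  have "(\<lambda>t. c * mode \<xi> (x + t *\<^sub>R axis i 1)) differentiable (at 0)" for x i
    using mode_directional_derivative by (rule differentiableI_vector)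
  then show ?case
    by (auto intro!: continuous_intros continuous_on_mode Suc simp: partial_deriv_mode simp del: mult_minus_left)
qed

lemma smooth_periodic_mode:
  assumes "\<xi> \<in> dual_lattice a b" shows "smooth_periodic a b (mode \<xi>)"
proof -
  have "mode \<xi> (x + (b $ i - a $ i) *\<^sub>R axis i 1) = mode \<xi> x" for i x
  proof -
    obtain m :: int where m: "\<xi> $ i * (b $ i - a $ i) = 2 * pi * of_int m"
      using assms unfolding dual_lattice_def by blast
    have "cis (2 * pi * of_int m) = 1" by (rule cis_multiple_2pi) simp
    then show ?thesis unfolding mode_translate m[symmetric] by (simp add: mult.commute)
  qed
  then show ?thesis using Ck_mode[of _ 1 \<xi>] by (simp add: smooth_periodic_def)
qed

lemma laplacian_mode: "laplacian (mode \<xi>) x = - of_real ((norm \<xi>)\<^sup>2) * mode \<xi> x"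
proof -
  have "laplacian (mode \<xi>) x = (\<Sum>i\<in>UNIV. (\<i> * of_real (\<xi> $ i)) * (\<i> * of_real (\<xi> $ i)) * mode \<xi> x)"
    using partial_deriv_mode[of _ 1 \<xi>] by (simp add: laplacian_def partial_deriv_mode)
  also have "\<dots> = (\<Sum>i\<in>UNIV. - of_real ((\<xi> $ i)\<^sup>2) * mode \<xi> x)"
    unfolding power2_eq_square[symmetric] by (simp add: power_mult_distrib)
  also have "\<dots> = - (\<Sum>i\<in>UNIV. of_real ((\<xi> $ i)\<^sup>2)) * mode \<xi> x"
    by (simp add: sum_distrib_right sum_negf)
  also have "(\<Sum>i\<in>UNIV. of_real ((\<xi> $ i)\<^sup>2)) = complex_of_real ((norm \<xi>)\<^sup>2)"
  proof -
    have "(norm \<xi>)\<^sup>2 = (\<Sum>i\<in>UNIV. (\<xi> $ i)\<^sup>2)"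
      by (simp add: power2_norm_eq_inner inner_vec_def) (simp add: power2_eq_square)
    then show ?thesis by (simp only: of_real_sum)
  qed
  finally show ?thesis .
qed

lemma finite_measure_lebesgue_on_box: "finite_measure (lebesgue_on (box a (b::'a::euclidean_space)))"
  by (rule finite_measure_lebesgue_on) simp

lemma mode_in_L2: "mode \<xi> \<in> L2_space (lebesgue_on (box a b))"
  by (rule bounded_in_L2_space[OF finite_measure_lebesgue_on_box, where C = 1])
    (auto intro!: continuous_imp_measurable_on_sets_lebesgue continuous_on_mode)

text \<open>The mode is itself smooth and periodic, so it can serve as its own approximating sequence in the closure
that defines the periodic Laplacian.\<close>

lemma mode_in_periodic_laplacian:
  assumes "\<xi> \<in> dual_lattice a b"
  shows "(mode \<xi>, \<lambda>x. - of_real ((norm \<xi>)\<^sup>2) * mode \<xi> x) \<in> periodic_laplacian a b"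
proof -
  have "L2_norm (lebesgue_on (box a b)) (\<lambda>x. mode \<xi> x - mode \<xi> x) = 0"
    "L2_norm (lebesgue_on (box a b)) (\<lambda>x. laplacian (mode \<xi>) x - (- of_real ((norm \<xi>)\<^sup>2) * mode \<xi> x)) = 0"
    unfolding laplacian_mode by (simp_all add: L2_norm_def)
  then show ?thesis unfolding periodic_laplacian_def Let_def
    using mode_in_L2[of \<xi> a b] L2_space_cmult[OF mode_in_L2[of \<xi> a b], of "- of_real ((norm \<xi>)\<^sup>2)"]
      smooth_periodic_mode[OF assms] by auto
qed

lemma heat_semigroup_mode:
  assumes "heat_semigroup a b S" "\<xi> \<in> dual_lattice a b" "t \<ge> 0"
  shows "AE x in lebesgue_on (box a b). S t (mode \<xi>) x = of_real (exp (- (norm \<xi>)\<^sup>2 * t)) * mode \<xi> x"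
  using assms mode_in_periodic_laplacian[OF assms(2)]
  by (intro C0_semigroup_eigenvector) (auto simp: heat_semigroup_def)

lemma integral_cis_period:
  assumes "\<alpha> \<le> \<beta>" "k \<noteq> 0" "k * (\<beta> - \<alpha>) = 2 * pi * of_int m"
  shows "(LINT t|lborel. indicator {\<alpha><..<\<beta>} t *\<^sub>R cis (t * k)) = 0"
proof -
  have "(LINT t|lborel. indicator {\<alpha><..<\<beta>} t *\<^sub>R cis (t * k)) = (LINT t|lborel. indicator {\<alpha>..\<beta>} t *\<^sub>R cis (t * k))"
  proof (rule integral_cong_AE)
    have [measurable]: "(\<lambda>t. cis (t * k)) \<in> borel_measurable borel"
      unfolding cis_conv_exp by (intro borel_measurable_continuous_onI continuous_intros)
    show "(\<lambda>t. indicator {\<alpha><..<\<beta>} t *\<^sub>R cis (t * k)) \<in> borel_measurable lborel"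
      "(\<lambda>t. indicator {\<alpha>..\<beta>} t *\<^sub>R cis (t * k)) \<in> borel_measurable lborel" by simp_all
    show "AE t in lborel. indicator {\<alpha><..<\<beta>} t *\<^sub>R cis (t * k) = indicator {\<alpha>..\<beta>} t *\<^sub>R cis (t * k)"
      using AE_lborel_singleton[of \<alpha>] AE_lborel_singleton[of \<beta>]
      by eventually_elim (auto simp: indicator_def)
  qed
  also have "\<dots> = 1 / (\<i> * of_real k) * cis (\<beta> * k) - 1 / (\<i> * of_real k) * cis (\<alpha> * k)"
  proof (rule integral_FTC_atLeastAtMost[OF assms(1)])
    fix t
    have "((\<lambda>t. 1 / (\<i> * of_real k) * cis (t * k)) has_vector_derivative (1 / (\<i> * of_real k) * (\<i> * of_real k * cis (t * k)))) (at t within {\<alpha>..\<beta>})"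
      by (intro has_vector_derivative_mult_right cis_has_vector_derivative)
    then show "((\<lambda>t. 1 / (\<i> * of_real k) * cis (t * k)) has_vector_derivative cis (t * k)) (at t within {\<alpha>..\<beta>})"
      using assms(2) by simp
  next
    show "continuous_on {\<alpha>..\<beta>} (\<lambda>t. cis (t * k))" unfolding cis_conv_exp by (intro continuous_intros)
  qed
  also have "cis (\<beta> * k) = cis (\<alpha> * k) * cis (2 * pi * of_int m)"
    unfolding cis_mult assms(3)[symmetric] by (simp add: algebra_simps)
  also have "cis (2 * pi * of_int m) = 1" by (rule cis_multiple_2pi) simp
  finally show ?thesis by simp
qed

text \<open>Fubini for a product of functions of the separate coordinates, via the presentation of Lebesgue measure
as a product measure.\<close>

lemma integral_box_prod:
  fixes g :: "'a::euclidean_space \<Rightarrow> real \<Rightarrow> complex"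
  assumes "\<And>e. e \<in> Basis \<Longrightarrow> integrable lborel (g e)"
  shows "(LINT x|lborel. (\<Prod>e\<in>Basis. g e (x \<bullet> e))) = (\<Prod>e\<in>Basis. LINT t|lborel. g e t)"
proof -
  interpret product_sigma_finite "\<lambda>_::'a. lborel :: real measure" by unfold_locales
  have g_m: "g e \<in> borel_measurable borel" if "e \<in> Basis" for e
    using borel_measurable_integrable[OF assms[OF that]] by simp
  have "(LINT x|lborel. (\<Prod>e\<in>Basis. g e (x \<bullet> e)))
      = (LINT f|(\<Pi>\<^sub>M b\<in>Basis. lborel). (\<Prod>e\<in>Basis. g e ((\<Sum>b\<in>Basis. f b *\<^sub>R b) \<bullet> e)))"
  proof (subst lborel_eq, rule integral_distr)
    show "(\<lambda>f. \<Sum>b\<in>Basis. f b *\<^sub>R b) \<in> borel_measurable (\<Pi>\<^sub>M b\<in>(Basis::'a set). lborel)"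
      by (intro borel_measurable_sum borel_measurable_scaleR borel_measurable_const)
        (use measurable_component_singleton[of _ "Basis::'a set" "\<lambda>_. lborel::real measure"] in simp)
    show "(\<lambda>x. \<Prod>e\<in>Basis. g e (x \<bullet> e)) \<in> borel_measurable borel"
      by (intro borel_measurable_prod measurable_compose[OF _ g_m]) auto
  qed
  also have "\<dots> = (LINT f|(\<Pi>\<^sub>M b\<in>(Basis::'a set). lborel). (\<Prod>e\<in>Basis. g e (f e)))"
    by (intro Bochner_Integration.integral_cong prod.cong refl) simp
  also have "\<dots> = (\<Prod>e\<in>Basis. LINT t|lborel. g e t)"
    by (rule product_integral_prod) (auto simp: assms)
  finally show ?thesis .
qed

text \<open>The integral factors over the coordinates, and a coordinate in which the frequency is nonzero contributes
the integral of an exponential over a whole number of its periods.\<close>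

lemma integral_mode_eq_0:
  fixes a b :: "real ^ 'd"
  assumes box: "\<And>i. a $ i < b $ i" and \<xi>: "\<xi> \<in> dual_lattice a b" "\<xi> \<noteq> 0"
  shows "(LINT x|lebesgue_on (box a b). mode \<xi> x) = 0"
proof -
  define g :: "real ^ 'd \<Rightarrow> real \<Rightarrow> complex" where
    "g = (\<lambda>e t. indicator {a \<bullet> e<..<b \<bullet> e} t *\<^sub>R cis (t * (\<xi> \<bullet> e)))"
  have cis_m [measurable]: "(\<lambda>t. cis (t * k)) \<in> borel_measurable borel" for k
    unfolding cis_conv_exp by (intro borel_measurable_continuous_onI continuous_intros)
  have mode_m [measurable]: "mode \<xi> \<in> borel_measurable borel"
    by (intro borel_measurable_continuous_onI continuous_on_mode)
  have "(LINT x|lebesgue_on (box a b). mode \<xi> x) = (LINT x|lebesgue. indicator (box a b) x *\<^sub>R mode \<xi> x)"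
    by (rule integral_restrict_space) simp
  also have "\<dots> = (LINT x|lborel. indicator (box a b) x *\<^sub>R mode \<xi> x)"
    by (rule integral_completion) simp
  also have "\<dots> = (LINT x|lborel. (\<Prod>e\<in>Basis. g e (x \<bullet> e)))"
  proof (rule Bochner_Integration.integral_cong[OF refl])
    fix x :: "real ^ 'd"
    have "mode \<xi> x = (\<Prod>e\<in>Basis. cis ((x \<bullet> e) * (\<xi> \<bullet> e)))"
      unfolding mode_def by (subst euclidean_inner) (simp add: cis_conv_exp sum_distrib_left exp_sum mult.commute)
    moreover have "(indicator (box a b) x :: real) = (\<Prod>e\<in>Basis. indicator {a \<bullet> e<..<b \<bullet> e} (x \<bullet> e))"
      by (cases "x \<in> box a b") (auto simp: mem_box prod_zero_iff indicator_def)
    ultimately show "indicator (box a b) x *\<^sub>R mode \<xi> x = (\<Prod>e\<in>Basis. g e (x \<bullet> e))"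
      by (simp add: g_def scaleR_conv_of_real prod.distrib)
  qed
  also have "\<dots> = (\<Prod>e\<in>Basis. LINT t|lborel. g e t)"
  proof (rule integral_box_prod)
    fix e :: "real ^ 'd"
    show "integrable lborel (g e)" unfolding g_def
    proof (rule Bochner_Integration.integrable_bound)
      show "integrable lborel (\<lambda>t. indicator {a \<bullet> e<..<b \<bullet> e} t :: real)"
        using emeasure_lborel_box_finite[of "a \<bullet> e" "b \<bullet> e"]
        by (intro integrable_real_indicator) (auto simp: box_real)
    qed (auto simp: indicator_def)
  qed
  also have "\<dots> = 0"
  proof -
    obtain i where i: "\<xi> $ i \<noteq> 0" using \<xi>(2) by (auto simp: vec_eq_iff)
    obtain m :: int where m: "\<xi> $ i * (b $ i - a $ i) = 2 * pi * of_int m"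
      using \<xi>(1) unfolding dual_lattice_def by blast
    have "(LINT t|lborel. g (axis i 1) t) = 0"
      unfolding g_def using i m box[of i] by (intro integral_cis_period[of _ _ _ m]) (auto simp: inner_axis)
    moreover have "axis i (1::real) \<in> Basis" by (auto simp: Basis_vec_def)
    ultimately show ?thesis by (auto simp: prod_zero_iff)
  qed
  finally show ?thesis .
qed

section \<open>Trigonometric sums and the heat semigroup\<close>

definition trig_sum :: "(real ^ 'd) set \<Rightarrow> (real ^ 'd \<Rightarrow> complex) \<Rightarrow> real ^ 'd \<Rightarrow> complex" where
  "trig_sum F c x = (\<Sum>\<xi>\<in>F. c \<xi> * mode \<xi> x)"

lemma trig_sum_in_L2: "trig_sum F c \<in> L2_space (lebesgue_on (box a b))"
  unfolding trig_sum_def[abs_def] by (intro L2_space_sum L2_space_cmult mode_in_L2)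

text \<open>Padding with zero coefficients lets two trigonometric sums be written over a common set of frequencies.\<close>

lemma trig_sum_extend:
  assumes "finite G" "F \<subseteq> G"
  shows "trig_sum F c = trig_sum G (\<lambda>\<xi>. if \<xi> \<in> F then c \<xi> else 0)"
  unfolding trig_sum_def[abs_def] using assms by (intro ext sum.mono_neutral_cong_left) auto

lemma integrable_mode: "integrable (lebesgue_on (box a b)) (mode \<xi>)"
proof -
  interpret finite_measure "lebesgue_on (box a b)" by (rule finite_measure_lebesgue_on_box)
  show ?thesis
    by (rule integrable_const_bound[where B = 1]) (auto intro!: L2_space_measurable mode_in_L2)
qed

text \<open>Parseval for finite sums: by orthogonality only the diagonal terms survive.\<close>

lemma L2_inner_trig_sum:
  fixes a b :: "real ^ 'd"
  assumes box: "\<And>i. a $ i < b $ i" and F: "finite F" "F \<subseteq> dual_lattice a b"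
  defines "D \<equiv> lebesgue_on (box a b)"
  shows "L2_inner D (trig_sum F c) (trig_sum F d) = measure D (space D) * (\<Sum>\<xi>\<in>F. c \<xi> \<bullet> d \<xi>)"
proof -
  interpret finite_measure D unfolding D_def by (rule finite_measure_lebesgue_on_box)
  have int: "integrable D (mode \<xi>)" for \<xi> unfolding D_def by (rule integrable_mode)
  have re: "u \<bullet> v = Re (u * cnj v)" for u v :: complex by (simp add: inner_complex_def)
  have "L2_inner D (trig_sum F c) (trig_sum F d)
      = (LINT x|D. Re (\<Sum>\<xi>\<in>F. \<Sum>\<eta>\<in>F. c \<xi> * cnj (d \<eta>) * mode (\<xi> + - \<eta>) x))"
    unfolding L2_inner_def re trig_sum_def
    by (simp only: cnj_sum sum_product complex_cnj_mult cnj_mode mode_add mult_ac)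
  also have "\<dots> = Re (LINT x|D. (\<Sum>\<xi>\<in>F. \<Sum>\<eta>\<in>F. c \<xi> * cnj (d \<eta>) * mode (\<xi> + - \<eta>) x))"
    by (intro integral_Re Bochner_Integration.integrable_sum integrable_mult_right int)
  also have "(LINT x|D. (\<Sum>\<xi>\<in>F. \<Sum>\<eta>\<in>F. c \<xi> * cnj (d \<eta>) * mode (\<xi> + - \<eta>) x))
      = (\<Sum>\<xi>\<in>F. \<Sum>\<eta>\<in>F. c \<xi> * cnj (d \<eta>) * (LINT x|D. mode (\<xi> + - \<eta>) x))"
    by (simp add: Bochner_Integration.integral_sum int)
  also have "\<dots> = (\<Sum>\<xi>\<in>F. \<Sum>\<eta>\<in>F. if \<eta> = \<xi> then c \<xi> * cnj (d \<xi>) * of_real (measure D (space D)) else 0)"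
  proof (intro sum.cong refl)
    fix \<xi> \<eta> assume "\<xi> \<in> F" "\<eta> \<in> F"
    then have in_dual: "\<xi> + - \<eta> \<in> dual_lattice a b" using F by (intro dual_lattice_add dual_lattice_uminus) auto
    show "c \<xi> * cnj (d \<eta>) * (LINT x|D. mode (\<xi> + - \<eta>) x)
        = (if \<eta> = \<xi> then c \<xi> * cnj (d \<xi>) * of_real (measure D (space D)) else 0)"
    proof (cases "\<eta> = \<xi>")
      case True
      then show ?thesis by (simp add: scaleR_conv_of_real)
    next
      case False
      then show ?thesis using integral_mode_eq_0[OF box in_dual] by (simp add: D_def)
    qed
  qed
  also have "\<dots> = of_real (measure D (space D)) * (\<Sum>\<xi>\<in>F. c \<xi> * cnj (d \<xi>))"
    using F(1) by (simp add: sum.delta sum_distrib_left mult_ac)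
  also have "Re \<dots> = measure D (space D) * (\<Sum>\<xi>\<in>F. c \<xi> \<bullet> d \<xi>)"
    unfolding re by simp
  finally show ?thesis .
qed

text \<open>The action of the heat semigroup on Fourier coefficients, by a Gaussian multiplier.\<close>

definition heat_coeff :: "real \<Rightarrow> (real ^ 'd \<Rightarrow> complex) \<Rightarrow> real ^ 'd \<Rightarrow> complex" where
  "heat_coeff t c \<xi> = of_real (exp (- (norm \<xi>)\<^sup>2 * t)) * c \<xi>"

lemma heat_semigroup_trig_sum:
  assumes heat: "heat_semigroup a b S" and t: "t \<ge> 0" and F: "finite F" "F \<subseteq> dual_lattice a b"
  shows "AE x in lebesgue_on (box a b). S t (trig_sum F c) x = trig_sum F (heat_coeff t c) x"
  using F
proof (induction F)
  case empty
  have "bounded_op (lebesgue_on (box a b)) (S t)"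
    using heat t by (simp add: heat_semigroup_def C0_semigroup_bounded_op)
  from bounded_op_cmult[OF this L2_space_zero, of 0] show ?case by (simp add: trig_sum_def[abs_def])
next
  case (insert \<xi> F)
  have op: "bounded_op (lebesgue_on (box a b)) (S t)"
    using heat t by (simp add: heat_semigroup_def C0_semigroup_bounded_op)
  have split: "trig_sum (insert \<xi> F) c' = (\<lambda>x. c' \<xi> * mode \<xi> x + 1 * trig_sum F c' x)" for c'
    using insert by (simp add: trig_sum_def[abs_def])
  have "\<xi> \<in> dual_lattice a b" using insert by simp
  note heat_semigroup_mode[OF heat this t]
  moreover have "AE x in lebesgue_on (box a b). S t (trig_sum F c) x = trig_sum F (heat_coeff t c) x"
    using insert by simp
  moreover note bounded_op_lincomb[OF op mode_in_L2 trig_sum_in_L2, of "c \<xi>" \<xi> 1 F c]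
  ultimately show ?case unfolding split
    by eventually_elim (simp add: heat_coeff_def)
qed

text \<open>The multiplier is real, hence it can be moved from one factor of Parseval's formula to the other.\<close>

lemma heat_trig_symmetric:
  fixes a b :: "real ^ 'd"
  assumes box: "\<And>i. a $ i < b $ i" and heat: "heat_semigroup a b S" and t: "t \<ge> 0"
    and F: "finite F" "F \<subseteq> dual_lattice a b" and G: "finite G" "G \<subseteq> dual_lattice a b"
  defines "D \<equiv> lebesgue_on (box a b)"
  shows "L2_inner D (S t (trig_sum F c)) (trig_sum G d) = L2_inner D (trig_sum F c) (S t (trig_sum G d))"
proof -
  define H where "H = F \<union> G"
  have H: "finite H" "H \<subseteq> dual_lattice a b" using F G by (auto simp: H_def)
  define c' d' where "c' = (\<lambda>\<xi>. if \<xi> \<in> F then c \<xi> else 0)" and "d' = (\<lambda>\<xi>. if \<xi> \<in> G then d \<xi> else 0)"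
  have ext: "trig_sum F c = trig_sum H c'" "trig_sum G d = trig_sum H d'"
    unfolding c'_def d'_def by (intro trig_sum_extend; use H in \<open>auto simp: H_def\<close>)+
  have op: "bounded_op D (S t)"
    using heat t by (simp add: D_def heat_semigroup_def C0_semigroup_bounded_op)
  have L2: "trig_sum H e \<in> L2_space D" for e unfolding D_def by (rule trig_sum_in_L2)
  have ae: "AE x in D. S t (trig_sum H e) x = trig_sum H (heat_coeff t e) x" for e
    unfolding D_def by (rule heat_semigroup_trig_sum[OF heat t H])
  have "L2_inner D (S t (trig_sum H c')) (trig_sum H d') = L2_inner D (trig_sum H (heat_coeff t c')) (trig_sum H d')"
    by (intro L2_inner_cong_AE ae L2_space_measurable L2 bounded_op_L2[OF op]) simp
  also have "\<dots> = L2_inner D (trig_sum H c') (trig_sum H (heat_coeff t d'))"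
    unfolding D_def L2_inner_trig_sum[OF box H]
    by (simp add: heat_coeff_def scaleR_conv_of_real[symmetric])
  also have "\<dots> = L2_inner D (trig_sum H c') (S t (trig_sum H d'))"
    by (intro L2_inner_cong_AE AE_symmetric[OF ae] L2_space_measurable L2 bounded_op_L2[OF op]) simp
  finally show ?thesis unfolding ext .
qed

text \<open>The multiplier is at most one in modulus.\<close>

lemma heat_trig_contraction:
  fixes a b :: "real ^ 'd"
  assumes box: "\<And>i. a $ i < b $ i" and heat: "heat_semigroup a b S" and t: "t \<ge> 0"
    and F: "finite F" "F \<subseteq> dual_lattice a b"
  defines "D \<equiv> lebesgue_on (box a b)"
  shows "L2_norm D (S t (trig_sum F c)) \<le> L2_norm D (trig_sum F c)"
proof (rule power2_le_imp_le)
  have op: "bounded_op D (S t)"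
    using heat t by (simp add: D_def heat_semigroup_def C0_semigroup_bounded_op)
  have L2: "trig_sum F e \<in> L2_space D" for e unfolding D_def by (rule trig_sum_in_L2)
  have "AE x in D. S t (trig_sum F c) x = trig_sum F (heat_coeff t c) x"
    unfolding D_def by (rule heat_semigroup_trig_sum[OF heat t F])
  then have "L2_norm D (S t (trig_sum F c)) = L2_norm D (trig_sum F (heat_coeff t c))"
    by (intro L2_norm_cong_AE L2_space_measurable L2 bounded_op_L2[OF op])
  then have "(L2_norm D (S t (trig_sum F c)))\<^sup>2
      = measure D (space D) * (\<Sum>\<xi>\<in>F. heat_coeff t c \<xi> \<bullet> heat_coeff t c \<xi>)"
    by (simp add: L2_norm_square D_def L2_inner_trig_sum[OF box F])
  also have "\<dots> \<le> measure D (space D) * (\<Sum>\<xi>\<in>F. c \<xi> \<bullet> c \<xi>)"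
  proof (intro mult_left_mono sum_mono)
    fix \<xi>
    have "cmod (heat_coeff t c \<xi>) \<le> 1 * cmod (c \<xi>)"
      unfolding heat_coeff_def norm_mult using t by (intro mult_right_mono) auto
    then show "heat_coeff t c \<xi> \<bullet> heat_coeff t c \<xi> \<le> c \<xi> \<bullet> c \<xi>"
      unfolding power2_norm_eq_inner[symmetric] by (intro power_mono) auto
  qed simp
  also have "\<dots> = (L2_norm D (trig_sum F c))\<^sup>2"
    by (simp add: L2_norm_square D_def L2_inner_trig_sum[OF box F])
  finally show "(L2_norm D (S t (trig_sum F c)))\<^sup>2 \<le> (L2_norm D (trig_sum F c))\<^sup>2" .
qed simp

section \<open>Density of trigonometric sums\<close>

text \<open>Allowing the set of frequencies to vary makes this a self-conjugate algebra of functions, as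
Stone--Weierstrass requires.\<close>

definition trig_poly :: "real ^ 'd \<Rightarrow> real ^ 'd \<Rightarrow> (real ^ 'd \<Rightarrow> complex) set" where
  "trig_poly a b = {trig_sum F c | F c. finite F \<and> F \<subseteq> dual_lattice a b}"

lemma trig_poly_add:
  assumes "f \<in> trig_poly a b" "g \<in> trig_poly a b"
  shows "(\<lambda>x. f x + g x) \<in> trig_poly a b"
proof -
  obtain F c G d where F: "finite F" "F \<subseteq> dual_lattice a b" "f = trig_sum F c"
    and G: "finite G" "G \<subseteq> dual_lattice a b" "g = trig_sum G d"
    using assms unfolding trig_poly_def by blast
  define c' d' where "c' = (\<lambda>\<xi>. if \<xi> \<in> F then c \<xi> else 0)" and "d' = (\<lambda>\<xi>. if \<xi> \<in> G then d \<xi> else 0)"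
  have ext: "f = trig_sum (F \<union> G) c'" "g = trig_sum (F \<union> G) d'"
    unfolding F(3) G(3) c'_def d'_def by (intro trig_sum_extend; use F G in auto)+
  have "(\<lambda>x. f x + g x) = trig_sum (F \<union> G) (\<lambda>\<xi>. c' \<xi> + d' \<xi>)"
    unfolding ext trig_sum_def[abs_def] by (simp add: sum.distrib distrib_right)
  then show ?thesis unfolding trig_poly_def using F G by auto
qed

lemma trig_poly_mode:
  assumes "\<xi> \<in> dual_lattice a b" shows "(\<lambda>x. c * mode \<xi> x) \<in> trig_poly a b"
proof -
  have "(\<lambda>x. c * mode \<xi> x) = trig_sum {\<xi>} (\<lambda>_. c)" by (simp add: trig_sum_def[abs_def])
  then show ?thesis unfolding trig_poly_def using assms by auto
qed

lemma trig_poly_const: "(\<lambda>x. c) \<in> trig_poly a b"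
  using trig_poly_mode[OF dual_lattice_0, of c a b] by simp

lemma trig_poly_sum:
  "(\<And>i. i \<in> A \<Longrightarrow> f i \<in> trig_poly a b) \<Longrightarrow> (\<lambda>x. \<Sum>i\<in>A. f i x) \<in> trig_poly a b"
  by (induction A rule: infinite_finite_induct) (auto intro: trig_poly_const trig_poly_add)

lemma trig_poly_mult:
  assumes "f \<in> trig_poly a b" "g \<in> trig_poly a b"
  shows "(\<lambda>x. f x * g x) \<in> trig_poly a b"
proof -
  obtain F c G d where F: "F \<subseteq> dual_lattice a b" "f = trig_sum F c"
    and G: "G \<subseteq> dual_lattice a b" "g = trig_sum G d"
    using assms unfolding trig_poly_def by blast
  have "f x * g x = (\<Sum>\<xi>\<in>F. \<Sum>\<eta>\<in>G. c \<xi> * d \<eta> * mode (\<xi> + \<eta>) x)" for x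
    unfolding F(2) G(2) trig_sum_def by (simp only: sum_product mode_add mult_ac)
  moreover have "(\<lambda>x. c \<xi> * d \<eta> * mode (\<xi> + \<eta>) x) \<in> trig_poly a b" if "\<xi> \<in> F" "\<eta> \<in> G" for \<xi> \<eta>
    using that F G by (intro trig_poly_mode dual_lattice_add) auto
  ultimately show ?thesis by (simp only:) (intro trig_poly_sum; blast)
qed

lemma trig_poly_in_L2: "f \<in> trig_poly a b \<Longrightarrow> f \<in> L2_space (lebesgue_on (box a b))"
  unfolding trig_poly_def by (auto intro: trig_sum_in_L2)

definition base_freq :: "real ^ 'd \<Rightarrow> real ^ 'd \<Rightarrow> 'd \<Rightarrow> real ^ 'd" where
  "base_freq a b i = axis i (2 * pi / (b $ i - a $ i))"

text \<open>This map winds each edge of the box once around the unit circle; its image of the closed box is a torus,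
whose points are the classes of the closed box under identification of opposite faces.\<close>

definition torus_map :: "real ^ 'd \<Rightarrow> real ^ 'd \<Rightarrow> real ^ 'd \<Rightarrow> complex ^ 'd" where
  "torus_map a b x = (\<chi> i. mode (base_freq a b i) x)"

lemma base_freq_dual:
  assumes "\<And>i. a $ i < b $ i" shows "base_freq a b i \<in> dual_lattice a b"
  unfolding dual_lattice_def
proof (intro CollectI allI)
  fix j
  show "\<exists>m::int. base_freq a b i $ j * (b $ j - a $ j) = 2 * pi * of_int m"
    using assms[of i] by (intro exI[of _ "if i = j then 1 else 0"]) (auto simp: base_freq_def axis_def)
qed

text \<open>Two distinct points of the closed box with the same image differ by a full period in some coordinate, so
both lie on faces of the box. Consequently a function that vanishes off the open box factors through the
torus.\<close>

lemma torus_map_eq_cases: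
  assumes box: "\<And>i. a $ i < b $ i" and xy: "x \<in> cbox a b" "y \<in> cbox a b" "torus_map a b x = torus_map a b y"
  shows "x = y \<or> (x \<notin> box a b \<and> y \<notin> box a b)"
proof (rule ccontr)
  assume neg: "\<not> ?thesis"
  then obtain i where i: "x $ i \<noteq> y $ i" by (auto simp: vec_eq_iff)
  define L where "L = b $ i - a $ i"
  have L: "L > 0" using box[of i] by (simp add: L_def)
  have "cis (2 * pi / L * x $ i) = cis (2 * pi / L * y $ i)"
    using xy(3) by (auto simp: torus_map_def vec_eq_iff mode_def base_freq_def inner_axis' L_def)
  then have "cis (2 * pi / L * x $ i - 2 * pi / L * y $ i) = 1"
    by (simp add: cis_divide[symmetric])
  then have "cos (2 * pi / L * x $ i - 2 * pi / L * y $ i) = 1"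
    by (metis cis.simps(1) one_complex.simps(1))
  then obtain m :: int where m: "2 * pi / L * x $ i - 2 * pi / L * y $ i = of_int m * 2 * pi"
    unfolding cos_one_2pi_int by blast
  have "x $ i - y $ i = L / (2 * pi) * (2 * pi / L * x $ i - 2 * pi / L * y $ i)"
    using L by (simp add: right_diff_distrib)
  also have "\<dots> = of_int m * L" unfolding m by simp
  finally have xy_i: "x $ i - y $ i = of_int m * L" .
  with i have "m \<noteq> 0" by auto
  then have "m \<ge> 1 \<or> m \<le> -1" by linarith
  moreover have b: "a $ i \<le> x $ i" "x $ i \<le> b $ i" "a $ i \<le> y $ i" "y $ i \<le> b $ i"
    using xy(1,2) by (auto simp: mem_box_cart)
  moreover have "m \<ge> 1 \<Longrightarrow> of_int m * L \<ge> 1 * L" using L by (intro mult_right_mono) auto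
  moreover have "m \<le> -1 \<Longrightarrow> of_int m * L \<le> (-1) * L"
    using L by (intro mult_right_mono) (auto simp: of_int_le_iff[of m "-1", where 'a=real, symmetric] simp del: of_int_le_iff)
  ultimately have "(x $ i = b $ i \<and> y $ i = a $ i) \<or> (x $ i = a $ i \<and> y $ i = b $ i)"
    using xy_i unfolding L_def by (elim disjE) auto
  then have "x \<notin> box a b \<and> y \<notin> box a b" by (auto simp: mem_box_cart intro!: exI[of _ i])
  with neg show False by simp
qed

text \<open>A real-linear functional of the torus coordinates is a combination of their real and imaginary parts, that
is, of cosines and sines of the basic frequencies.\<close>

lemma trig_poly_linear_torus:
  fixes a b :: "real ^ 'd" and h :: "complex ^ 'd \<Rightarrow> real"
  assumes box: "\<And>i. a $ i < b $ i" and h: "bounded_linear h"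
  shows "(\<lambda>x. complex_of_real (h (torus_map a b x))) \<in> trig_poly a b"
proof -
  interpret h: bounded_linear h by fact
  define \<alpha> \<beta> where "\<alpha> = (\<lambda>i. h (axis i 1))" and "\<beta> = (\<lambda>i. h (axis i \<i>))"
  have h_eq: "h z = (\<Sum>i\<in>UNIV. Re (z $ i) * \<alpha> i + Im (z $ i) * \<beta> i)" for z
  proof -
    have "z = (\<Sum>i\<in>UNIV. Re (z $ i) *\<^sub>R axis i 1 + Im (z $ i) *\<^sub>R axis i \<i>)"
    proof (rule vec_eq_iff[THEN iffD2], rule allI)
      fix j
      have "(\<Sum>i\<in>UNIV. Re (z $ i) *\<^sub>R axis i 1 + Im (z $ i) *\<^sub>R axis i \<i>) $ j
          = (\<Sum>i\<in>UNIV. if i = j then z $ i else 0)"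
        unfolding sum_component by (intro sum.cong) (auto simp: axis_def complex_eq_iff)
      then show "z $ j = (\<Sum>i\<in>UNIV. Re (z $ i) *\<^sub>R axis i 1 + Im (z $ i) *\<^sub>R axis i \<i>) $ j"
        by simp
    qed
    then have "h z = h (\<Sum>i\<in>UNIV. Re (z $ i) *\<^sub>R axis i 1 + Im (z $ i) *\<^sub>R axis i \<i>)" by simp
    then show ?thesis by (simp add: h.sum h.add h.scaleR \<alpha>_def \<beta>_def)
  qed
  have re: "complex_of_real (Re w) = (w + cnj w) / 2" "complex_of_real (Im w) = (w - cnj w) / (2 * \<i>)" for w
    by (simp_all add: complex_eq_iff)
  have "complex_of_real (h (torus_map a b x)) = (\<Sum>i\<in>UNIV.
      (of_real (\<alpha> i) / 2 + of_real (\<beta> i) / (2 * \<i>)) * mode (base_freq a b i) x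
      + (of_real (\<alpha> i) / 2 - of_real (\<beta> i) / (2 * \<i>)) * mode (- base_freq a b i) x)" for x
    unfolding h_eq of_real_sum
  proof (intro sum.cong refl)
    fix i
    show "complex_of_real (Re (torus_map a b x $ i) * \<alpha> i + Im (torus_map a b x $ i) * \<beta> i) =
      (of_real (\<alpha> i) / 2 + of_real (\<beta> i) / (2 * \<i>)) * mode (base_freq a b i) x
      + (of_real (\<alpha> i) / 2 - of_real (\<beta> i) / (2 * \<i>)) * mode (- base_freq a b i) x"
      unfolding of_real_add of_real_mult re torus_map_def cnj_mode[symmetric]
      by (simp add: field_simps)
  qed
  then show ?thesis
    by (simp only:) (intro trig_poly_sum trig_poly_add trig_poly_mode dual_lattice_uminus base_freq_dual box)
qed

lemma trig_poly_polynomial_torus: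
  fixes a b :: "real ^ 'd"
  assumes box: "\<And>i. a $ i < b $ i" and p: "real_polynomial_function p"
  shows "(\<lambda>x. complex_of_real (p (torus_map a b x))) \<in> trig_poly a b"
  using p
proof (induction p rule: real_polynomial_function.induct)
  case (linear f)
  then show ?case by (intro trig_poly_linear_torus box)
next
  case (const c)
  show ?case by (rule trig_poly_const)
next
  case (add f g)
  then show ?case unfolding of_real_add by (intro trig_poly_add)
next
  case (mult f g)
  then show ?case unfolding of_real_mult by (intro trig_poly_mult)
qed

text \<open>\<open>g\<close> descends to a continuous function on the torus, since a continuous map of a compact space onto a
Hausdorff space is a quotient map. By Stone--Weierstrass this function is a uniform limit of real
polynomials in the torus coordinates, and these pull back to trigonometric sums.\<close>

lemma trig_poly_uniform_approx:
  fixes a b :: "real ^ 'd" and g :: "real ^ 'd \<Rightarrow> real"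
  assumes box: "\<And>i. a $ i < b $ i" and g: "continuous_on UNIV g" "\<And>x. x \<notin> box a b \<Longrightarrow> g x = 0" and e: "e > 0"
  obtains p where "p \<in> trig_poly a b" "\<And>x. x \<in> box a b \<Longrightarrow> cmod (of_real (g x) - p x) < e"
proof -
  let ?E = "torus_map a b"
  define T where "T = ?E ` cbox a b"
  \<comment> \<open>\<open>h\<close> is the function on the torus induced by \<open>g\<close>; the choice of a preimage does not matter.\<close>
  define h where "h = (\<lambda>z. g (SOME x. x \<in> cbox a b \<and> ?E x = z))"
  have h: "h (?E x) = g x" if x: "x \<in> cbox a b" for x
  proof -
    define y where "y = (SOME y. y \<in> cbox a b \<and> ?E y = ?E x)"
    have y: "y \<in> cbox a b \<and> ?E y = ?E x" unfolding y_def by (rule someI[of _ x]) (use x in simp)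
    then have "g y = g x" using torus_map_eq_cases[OF box _ x, of y] g(2) by auto
    then show ?thesis by (simp add: h_def y_def)
  qed
  have E_cont: "continuous_on (cbox a b) ?E"
    unfolding torus_map_def[abs_def] by (intro continuous_on_vec_lambda continuous_on_mode)
  have "compact T" unfolding T_def by (intro compact_continuous_image E_cont compact_cbox)
  moreover have "continuous_on T h"
    unfolding continuous_openin_preimage_eq
  proof (intro allI impI)
    fix U :: "real set" assume U: "open U"
    have "openin (top_of_set (cbox a b)) (cbox a b \<inter> g -` U)"
      using continuous_on_subset[OF g(1), of "cbox a b"] U unfolding continuous_openin_preimage_eq by blast
    also have "cbox a b \<inter> g -` U = cbox a b \<inter> ?E -` (T \<inter> h -` U)"
    proof (intro set_eqI iffI)
      fix x assume "x \<in> cbox a b \<inter> g -` U"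
      then show "x \<in> cbox a b \<inter> ?E -` (T \<inter> h -` U)" by (simp add: h T_def)
    next
      fix x assume "x \<in> cbox a b \<inter> ?E -` (T \<inter> h -` U)"
      then have "x \<in> cbox a b" "h (?E x) \<in> U" by auto
      then show "x \<in> cbox a b \<inter> g -` U" using h[of x] by simp
    qed
    finally show "openin (top_of_set T) (T \<inter> h -` U)"
      by (subst (asm) Abstract_Topology_2.continuous_imp_quotient_map[OF E_cont T_def[symmetric] compact_cbox]) auto
  qed
  ultimately obtain p where p: "real_polynomial_function p" "\<And>z. z \<in> T \<Longrightarrow> \<bar>h z - p z\<bar> < e"
    using Stone_Weierstrass_real_polynomial_function[OF _ _ e] by blast
  show thesis
  proof (rule that[OF trig_poly_polynomial_torus[OF box p(1)]])
    fix x assume "x \<in> box a b"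
    then have x: "x \<in> cbox a b" using box_subset_cbox by blast
    then have "\<bar>g x - p (?E x)\<bar> < e" using p(2)[of "?E x"] h by (auto simp: T_def)
    then show "cmod (of_real (g x) - of_real (p (?E x))) < e"
      by (metis norm_of_real of_real_diff)
  qed
qed

definition trig_approx :: "real ^ 'd \<Rightarrow> real ^ 'd \<Rightarrow> (real ^ 'd \<Rightarrow> complex) \<Rightarrow> bool" where
  "trig_approx a b u \<longleftrightarrow> (\<forall>e>0. \<exists>p\<in>trig_poly a b. L2_norm (lebesgue_on (box a b)) (\<lambda>x. u x - p x) < e)"

lemma trig_approx_limit:
  fixes a b :: "real ^ 'd"
  defines "D \<equiv> lebesgue_on (box a b)"
  assumes u: "u \<in> L2_space D" and v: "\<And>n. v n \<in> L2_space D" "\<And>n. trig_approx a b (v n)"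
    and lim: "(\<lambda>n. L2_norm D (\<lambda>x. v n x - u x)) \<longlonglongrightarrow> 0"
  shows "trig_approx a b u"
  unfolding trig_approx_def D_def[symmetric]
proof (intro allI impI)
  fix e :: real assume "e > 0"
  then have "eventually (\<lambda>n. L2_norm D (\<lambda>x. v n x - u x) < e / 2) sequentially"
    using order_tendstoD(2)[OF lim, of "e / 2"] by simp
  then obtain n where n: "L2_norm D (\<lambda>x. v n x - u x) < e / 2"
    using eventually_happens by force
  obtain p where p: "p \<in> trig_poly a b" "L2_norm D (\<lambda>x. v n x - p x) < e / 2"
    using v(2)[of n] \<open>e > 0\<close> unfolding trig_approx_def D_def by (meson half_gt_zero)
  have "L2_norm D (\<lambda>x. u x - p x) \<le> L2_norm D (\<lambda>x. u x - v n x) + L2_norm D (\<lambda>x. v n x - p x)"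
    using u v(1) trig_poly_in_L2[OF p(1)] unfolding D_def by (intro L2_norm_dist_triangle) auto
  also have "\<dots> < e" using n p(2) L2_norm_diff_commute[of D u "v n"] by simp
  finally show "\<exists>p\<in>trig_poly a b. L2_norm D (\<lambda>x. u x - p x) < e" using p(1) by blast
qed

lemma trig_approx_continuous:
  fixes a b :: "real ^ 'd" and w :: "real ^ 'd \<Rightarrow> complex"
  assumes box: "\<And>i. a $ i < b $ i" and w: "continuous_on UNIV w" "\<And>x. x \<notin> box a b \<Longrightarrow> w x = 0"
  shows "trig_approx a b w"
  unfolding trig_approx_def
proof (intro allI impI)
  fix e :: real assume e: "e > 0"
  define D where "D = lebesgue_on (box a b)"
  interpret finite_measure D unfolding D_def by (rule finite_measure_lebesgue_on_box)
  define m where "m = sqrt (measure D (space D))"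
  define d where "d = e / (2 * (m + 1))"
  have m: "m \<ge> 0" by (simp add: m_def)
  have d: "d > 0" using e m by (simp add: d_def)
  obtain p where p: "p \<in> trig_poly a b" "\<And>x. x \<in> box a b \<Longrightarrow> cmod (of_real (Re (w x)) - p x) < d"
    using trig_poly_uniform_approx[OF box _ _ d, of "\<lambda>x. Re (w x)"] w by (auto intro: continuous_intros)
  obtain q where q: "q \<in> trig_poly a b" "\<And>x. x \<in> box a b \<Longrightarrow> cmod (of_real (Im (w x)) - q x) < d"
    using trig_poly_uniform_approx[OF box _ _ d, of "\<lambda>x. Im (w x)"] w by (auto intro: continuous_intros)
  define r where "r = (\<lambda>x. p x + \<i> * q x)"
  have r: "r \<in> trig_poly a b"
    unfolding r_def by (intro trig_poly_add p trig_poly_mult[OF trig_poly_const q(1)])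
  have "cmod (w x - r x) \<le> 2 * d" if "x \<in> box a b" for x
  proof -
    have "w x - r x = (of_real (Re (w x)) - p x) + \<i> * (of_real (Im (w x)) - q x)"
      unfolding r_def by (subst complex_eq[of "w x"]) (simp add: algebra_simps)
    also have "cmod \<dots> \<le> cmod (of_real (Re (w x)) - p x) + cmod (\<i> * (of_real (Im (w x)) - q x))"
      by (rule norm_triangle_ineq)
    also have "\<dots> \<le> 2 * d" using p(2)[OF that] q(2)[OF that] by (simp add: norm_mult)
    finally show ?thesis .
  qed
  moreover have "w \<in> borel_measurable D"
    unfolding D_def using w(1) by (intro continuous_imp_measurable_on_sets_lebesgue continuous_on_subset[OF w(1)]) auto
  ultimately have "L2_norm D (\<lambda>x. w x - r x) \<le> 2 * d * m"
    unfolding m_def using d trig_poly_in_L2[OF r, THEN L2_space_measurable]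
    by (intro L2_norm_le_bound finite_measure_axioms) (auto simp: D_def)
  also have "\<dots> < e" using e m by (simp add: d_def field_simps)
  finally show "\<exists>p\<in>trig_poly a b. L2_norm (lebesgue_on (box a b)) (\<lambda>x. w x - p x) < e"
    using r unfolding D_def by blast
qed

text \<open>A measurable function is an almost-everywhere limit of continuous functions on the whole space. Clamping
their values to the ball of radius \<open>R\<close> and multiplying by cutoffs that increase to the indicator of the
open box makes dominated convergence applicable and produces functions that vanish outside the box.\<close>

lemma trig_approx_bounded:
  fixes a b :: "real ^ 'd" and u :: "real ^ 'd \<Rightarrow> complex"
  assumes box: "\<And>i. a $ i < b $ i" and u: "u \<in> borel_measurable (lebesgue_on (box a b))"
    and R: "\<And>x. cmod (u x) \<le> R" "R > 0"
  shows "trig_approx a b u"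
proof -
  define D where "D = lebesgue_on (box a b)"
  have fin: "finite_measure D" unfolding D_def by (rule finite_measure_lebesgue_on_box)
  interpret finite_measure D by fact
  have "u measurable_on (box a b)" using u by (simp add: measurable_on_iff_borel_measurable)
  then obtain N g where N: "negligible N" and g: "\<And>n::nat. continuous_on UNIV (g n)"
    and lim: "\<And>x. x \<notin> N \<Longrightarrow> (\<lambda>n. g n x) \<longlonglongrightarrow> (if x \<in> box a b then u x else 0)"
    unfolding measurable_on_def by blast
  \<comment> \<open>\<open>clamp\<close> is the radial retraction onto the ball of radius \<open>R\<close>.\<close>
  define clamp where "clamp = (\<lambda>z. z / of_real (max 1 (cmod z / R)))"
  define cut where "cut = (\<lambda>n x. min 1 (real n * infdist x (- box a b)))"
  define w where "w = (\<lambda>n x. of_real (cut n x) * clamp (g n x))"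
  have clamp_cont: "continuous_on UNIV clamp"
    unfolding clamp_def using R(2) by (intro continuous_intros) (auto simp: max_def)
  have clamp_id: "clamp z = z" if "cmod z \<le> R" for z
    using that R(2) by (simp add: clamp_def max_def)
  have clamp_le: "cmod (clamp z) \<le> R" for z
    using R(2) by (auto simp: clamp_def norm_divide max_def field_simps)
  have ne: "- box a b \<noteq> {}"
    using bounded_box[of a b] not_bounded_UNIV[where 'a="real^'d"] by (metis Compl_empty_eq double_complement)
  have cut01: "0 \<le> cut n x" "cut n x \<le> 1" for n x by (auto simp: cut_def infdist_nonneg)
  have w_cont: "continuous_on UNIV (w n)" for n
    unfolding w_def cut_def
    by (intro continuous_intros continuous_on_compose2[OF clamp_cont g]) auto
  have w_0: "w n x = 0" if "x \<notin> box a b" for n x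
    using that by (simp add: w_def cut_def)
  have w_le: "cmod (w n x) \<le> R" for n x
    unfolding w_def norm_mult using cut01[of n x] clamp_le[of "g n x"]
    using mult_mono[of "cut n x" 1 "cmod (clamp (g n x))" R] by simp
  have w_meas: "w n \<in> borel_measurable D" for n
    unfolding D_def by (intro continuous_imp_measurable_on_sets_lebesgue continuous_on_subset[OF w_cont]) auto
  have w_L2: "w n \<in> L2_space D" for n
    using fin w_meas w_le by (rule bounded_in_L2_space)
  have u_L2: "u \<in> L2_space D"
    using fin u R(1) unfolding D_def by (rule bounded_in_L2_space)
  have "AE x in D. x \<notin> N \<and> x \<in> box a b"
  proof -
    have "AE x in lebesgue. x \<in> box a b \<longrightarrow> x \<notin> N \<and> x \<in> box a b"
      using N AE_not_in[of N lebesgue] by (auto simp: negligible_iff_null_sets elim!: eventually_mono)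
    then show ?thesis unfolding D_def by (subst AE_restrict_space_iff) simp_all
  qed
  then have w_lim: "AE x in D. (\<lambda>n. w n x) \<longlonglongrightarrow> u x"
  proof eventually_elim
    case (elim x)
    have "(\<lambda>n. clamp (g n x)) \<longlonglongrightarrow> clamp (u x)"
      using lim[of x] elim clamp_cont
      by (intro isCont_tendsto_compose[where g = clamp]) (auto simp: continuous_on_eq_continuous_at)
    moreover have "(\<lambda>n. cut n x) \<longlonglongrightarrow> 1"
    proof -
      have "infdist x (- box a b) > 0"
        using elim ne by (intro infdist_pos_not_in_closed) auto
      then obtain k :: nat where "1 / infdist x (- box a b) < real k" using reals_Archimedean2 by blast
      then have k: "1 \<le> real k * infdist x (- box a b)" using \<open>infdist x (- box a b) > 0\<close> by (simp add: field_simps)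
      have "eventually (\<lambda>n. cut n x = 1) sequentially"
        using eventually_ge_at_top[of k]
      proof eventually_elim
        case (elim n)
        then have "real k * infdist x (- box a b) \<le> real n * infdist x (- box a b)"
          by (intro mult_right_mono) (auto simp: infdist_nonneg)
        then show ?case using k by (simp add: cut_def)
      qed
      then show ?thesis by (rule tendsto_eventually)
    qed
    ultimately have "(\<lambda>n. w n x) \<longlonglongrightarrow> of_real 1 * clamp (u x)"
      unfolding w_def by (intro tendsto_intros)
    then show ?case using clamp_id[OF R(1)] by simp
  qed
  have "(\<lambda>n. L2_norm D (\<lambda>x. w n x - u x)) \<longlonglongrightarrow> 0"
  proof (rule L2_dominated_convergence[OF w_meas _ w_lim])
    show "u \<in> borel_measurable D" using u by (simp add: D_def)
    show "AE x in D. cmod (w n x - u x) \<le> 2 * R" for n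
    proof (rule AE_I2)
      fix x
      show "cmod (w n x - u x) \<le> 2 * R"
        using norm_triangle_ineq4[of "w n x" "u x"] w_le[of n x] R(1)[of x] by linarith
    qed
  qed simp
  then show ?thesis
    using u_L2 w_L2 trig_approx_continuous[OF box w_cont w_0] trig_approx_limit[of u a b w] unfolding D_def by blast
qed

text \<open>Truncating the values of \<open>u\<close> at height \<open>n + 1\<close> reduces the claim to bounded functions.\<close>

lemma trig_poly_dense:
  fixes a b :: "real ^ 'd" and u :: "real ^ 'd \<Rightarrow> complex"
  assumes box: "\<And>i. a $ i < b $ i" and u: "u \<in> L2_space (lebesgue_on (box a b))"
  shows "trig_approx a b u"
proof -
  define D where "D = lebesgue_on (box a b)"
  define v where "v = (\<lambda>n x. if cmod (u x) \<le> real (Suc n) then u x else 0)"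
  have [measurable]: "u \<in> borel_measurable D" using u by (simp add: D_def L2_space_def)
  have v_meas [measurable]: "v n \<in> borel_measurable D" for n unfolding v_def by measurable
  have v_L2: "v n \<in> L2_space D" for n
    using u unfolding D_def[symmetric] by (rule L2_space_bounded_by[where C = 1]) (auto simp: v_def)
  have approx: "trig_approx a b (v n)" for n
    using v_meas[of n] unfolding D_def
    by (intro trig_approx_bounded[OF box, where R = "real (Suc n)"]) (auto simp: v_def)
  have "(\<lambda>n. L2_norm D (\<lambda>x. v n x - u x)) \<longlonglongrightarrow> 0"
  proof (rule L2_dominated_convergence[where g = "\<lambda>x. cmod (u x)"])
    show "AE x in D. (\<lambda>n. v n x) \<longlonglongrightarrow> u x"
    proof (rule AE_I2)
      fix x
      obtain k :: nat where "cmod (u x) \<le> real k" using real_arch_simple by blast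
      then have "\<forall>n\<ge>k. v n x = u x" by (auto simp: v_def)
      then have "eventually (\<lambda>n. v n x = u x) sequentially"
        unfolding eventually_sequentially by blast
      then show "(\<lambda>n. v n x) \<longlonglongrightarrow> u x" by (rule tendsto_eventually)
    qed
    show "integrable D (\<lambda>x. (cmod (u x))\<^sup>2)" using u by (simp add: D_def L2_space_def)
  qed (auto simp: v_def)
  then show ?thesis using trig_approx_limit[of u a b v] u v_L2 approx by (simp add: D_def)
qed

section \<open>The heat semigroup on square-integrable functions\<close>

lemma trig_sum_sequence:
  fixes a b :: "real ^ 'd"
  assumes box: "\<And>i. a $ i < b $ i" and u: "u \<in> L2_space (lebesgue_on (box a b))"
  obtains F c where "\<And>n::nat. finite (F n)" "\<And>n. F n \<subseteq> dual_lattice a b"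
    "(\<lambda>n. L2_norm (lebesgue_on (box a b)) (\<lambda>x. trig_sum (F n) (c n) x - u x)) \<longlonglongrightarrow> 0"
proof -
  let ?D = "lebesgue_on (box a b)"
  have "\<exists>F c. finite F \<and> F \<subseteq> dual_lattice a b \<and> L2_norm ?D (\<lambda>x. u x - trig_sum F c x) < 1 / real (Suc n)" for n
    using trig_poly_dense[OF box u] unfolding trig_approx_def trig_poly_def
    by (elim allE[of _ "1 / real (Suc n)"]) auto
  then obtain F c where Fc: "\<And>n. finite (F n)" "\<And>n. F n \<subseteq> dual_lattice a b"
    "\<And>n. L2_norm ?D (\<lambda>x. u x - trig_sum (F n) (c n) x) < 1 / real (Suc n)"
    by metis
  have "(\<lambda>n. L2_norm ?D (\<lambda>x. trig_sum (F n) (c n) x - u x)) \<longlonglongrightarrow> 0"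
  proof (rule tendsto_sandwich[of "\<lambda>_. 0" _ sequentially "\<lambda>n. 1 / real (Suc n)"])
    show "(\<lambda>n. 1 / real (Suc n)) \<longlonglongrightarrow> 0" by (rule LIMSEQ_Suc[OF lim_1_over_n])
    show "eventually (\<lambda>n. L2_norm ?D (\<lambda>x. trig_sum (F n) (c n) x - u x) \<le> 1 / real (Suc n)) sequentially"
      using Fc(3) by (subst L2_norm_diff_commute) (intro always_eventually allI less_imp_le)
  qed simp_all
  with Fc that show thesis by blast
qed

text \<open>Both sides are continuous in \<open>u\<close> and \<open>v\<close>, so the identity passes from trigonometric sums to their
closure.\<close>

lemma heat_semigroup_symmetric:
  fixes a b :: "real ^ 'd"
  assumes box: "\<And>i. a $ i < b $ i" and heat: "heat_semigroup a b S" and t: "t \<ge> 0"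
  defines "D \<equiv> lebesgue_on (box a b)"
  assumes u: "u \<in> L2_space D" and v: "v \<in> L2_space D"
  shows "L2_inner D (S t u) v = L2_inner D u (S t v)"
proof -
  obtain F c where F: "\<And>n::nat. finite (F n)" "\<And>n. F n \<subseteq> dual_lattice a b"
    "(\<lambda>n. L2_norm D (\<lambda>x. trig_sum (F n) (c n) x - u x)) \<longlonglongrightarrow> 0"
    using trig_sum_sequence[OF box u[unfolded D_def]] unfolding D_def by blast
  obtain G d where G: "\<And>n::nat. finite (G n)" "\<And>n. G n \<subseteq> dual_lattice a b"
    "(\<lambda>n. L2_norm D (\<lambda>x. trig_sum (G n) (d n) x - v x)) \<longlonglongrightarrow> 0"
    using trig_sum_sequence[OF box v[unfolded D_def]] unfolding D_def by blast
  have op: "bounded_op D (S t)"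
    using heat t by (simp add: D_def heat_semigroup_def C0_semigroup_bounded_op)
  have L2: "trig_sum H e \<in> L2_space D" for H e unfolding D_def by (rule trig_sum_in_L2)
  have "(\<lambda>n. L2_inner D (S t (trig_sum (F n) (c n))) (trig_sum (G n) (d n))) \<longlonglongrightarrow> L2_inner D (S t u) v"
    by (rule L2_inner_tendsto[OF bounded_op_L2[OF op L2] L2 bounded_op_L2[OF op u] v
          bounded_op_tendsto[OF op L2 u F(3)] G(3)])
  moreover have "(\<lambda>n. L2_inner D (trig_sum (F n) (c n)) (S t (trig_sum (G n) (d n)))) \<longlonglongrightarrow> L2_inner D u (S t v)"
    by (rule L2_inner_tendsto[OF L2 bounded_op_L2[OF op L2] u bounded_op_L2[OF op v]
          F(3) bounded_op_tendsto[OF op L2 v G(3)]])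
  moreover have "L2_inner D (S t (trig_sum (F n) (c n))) (trig_sum (G n) (d n))
      = L2_inner D (trig_sum (F n) (c n)) (S t (trig_sum (G n) (d n)))" for n
    unfolding D_def by (rule heat_trig_symmetric[OF box heat t F(1,2) G(1,2)])
  ultimately show ?thesis using LIMSEQ_unique by simp
qed

lemma heat_semigroup_contraction:
  fixes a b :: "real ^ 'd"
  assumes box: "\<And>i. a $ i < b $ i" and heat: "heat_semigroup a b S" and t: "t \<ge> 0"
  defines "D \<equiv> lebesgue_on (box a b)"
  assumes u: "u \<in> L2_space D"
  shows "L2_norm D (S t u) \<le> L2_norm D u"
proof (rule power2_le_imp_le)
  obtain F c where F: "\<And>n::nat. finite (F n)" "\<And>n. F n \<subseteq> dual_lattice a b"
    "(\<lambda>n. L2_norm D (\<lambda>x. trig_sum (F n) (c n) x - u x)) \<longlonglongrightarrow> 0"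
    using trig_sum_sequence[OF box u[unfolded D_def]] unfolding D_def by blast
  have op: "bounded_op D (S t)"
    using heat t by (simp add: D_def heat_semigroup_def C0_semigroup_bounded_op)
  have L2: "trig_sum H e \<in> L2_space D" for H e unfolding D_def by (rule trig_sum_in_L2)
  have "(\<lambda>n. L2_inner D (S t (trig_sum (F n) (c n))) (S t (trig_sum (F n) (c n)))) \<longlonglongrightarrow> L2_inner D (S t u) (S t u)"
    by (rule L2_inner_tendsto[OF bounded_op_L2[OF op L2] bounded_op_L2[OF op L2] bounded_op_L2[OF op u]
          bounded_op_L2[OF op u] bounded_op_tendsto[OF op L2 u F(3)] bounded_op_tendsto[OF op L2 u F(3)]])
  moreover have "(\<lambda>n. L2_inner D (trig_sum (F n) (c n)) (trig_sum (F n) (c n))) \<longlonglongrightarrow> L2_inner D u u"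
    by (rule L2_inner_tendsto[OF L2 L2 u u F(3) F(3)])
  moreover have "L2_inner D (S t (trig_sum (F n) (c n))) (S t (trig_sum (F n) (c n)))
      \<le> L2_inner D (trig_sum (F n) (c n)) (trig_sum (F n) (c n))" for n
    unfolding L2_norm_square[symmetric] D_def
    by (intro power_mono heat_trig_contraction[OF box heat t F(1,2)]) simp
  ultimately have "L2_inner D (S t u) (S t u) \<le> L2_inner D u u"
    by (intro LIMSEQ_le) auto
  then show "(L2_norm D (S t u))\<^sup>2 \<le> (L2_norm D u)\<^sup>2" by (simp add: L2_norm_square)
qed simp

section \<open>Decay of the energy\<close>

text \<open>The energy estimate rests on symmetry and contractivity of the semigroup and on the pointwise form of the
bound on \<open>\<kappa>\<close>; the geometry of the box enters through these properties alone.\<close>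

locale relaxed_energy =
  fixes D :: "'a measure" and S :: "real \<Rightarrow> ('a \<Rightarrow> complex) \<Rightarrow> 'a \<Rightarrow> complex" and V :: "'a \<Rightarrow> real"
    and \<tau> \<beta> M \<kappa> :: real
  assumes C0: "C0_semigroup D S"
    and symmetric: "\<And>t u v. t \<ge> 0 \<Longrightarrow> u \<in> L2_space D \<Longrightarrow> v \<in> L2_space D \<Longrightarrow> L2_inner D (S t u) v = L2_inner D u (S t v)"
    and contraction: "\<And>t u. t \<ge> 0 \<Longrightarrow> u \<in> L2_space D \<Longrightarrow> L2_norm D (S t u) \<le> L2_norm D u"
    and tau: "\<tau> > 0" and beta: "\<beta> > 0" and M: "M > 0"
    and V_meas: "V \<in> borel_measurable D"
    and V_bounds: "AE x in D. 0 \<le> V x \<and> V x + 3 * \<beta> * M\<^sup>2 \<le> \<kappa>"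
begin

definition kinetic :: "('a \<Rightarrow> complex) \<Rightarrow> real" where
  "kinetic u = (L2_norm D (S (\<tau>/2) u))\<^sup>2 - 4 * (L2_norm D (S (\<tau>/4) u))\<^sup>2"

definition pot_density :: "('a \<Rightarrow> complex) \<Rightarrow> 'a \<Rightarrow> real" where
  "pot_density u x = V x * (cmod (u x))\<^sup>2 + \<beta> / 2 * F_trunc M (u x) - \<kappa> * (cmod (u x))\<^sup>2"

text \<open>The gradient of the potential part of the energy. The factor that multiplies \<open>f_trunc\<close> is $\beta/2$, as
$\widetilde f$ is the gradient of $\widetilde F$ for the real inner product on the complex plane.\<close>

definition pot_grad :: "('a \<Rightarrow> complex) \<Rightarrow> 'a \<Rightarrow> complex" where
  "pot_grad u x = 2 * of_real (V x) * u x + of_real (\<beta> / 2) * f_trunc M (u x) - 2 * of_real \<kappa> * u x"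

lemma S_L2: "t \<ge> 0 \<Longrightarrow> u \<in> L2_space D \<Longrightarrow> S t u \<in> L2_space D"
  using bounded_op_L2[OF C0_semigroup_bounded_op[OF C0]] .

text \<open>Expanding the square and moving one factor $S(t)$ to the other side by symmetry turns the gradient of
$\|S(t)u\|^2$ into $2S(2t)u$. This is how the times $\tau/2$ and $\tau/4$ of the energy become $\tau$
and $\tau/2$ in the step.\<close>

lemma norm_S_add:
  assumes t: "t \<ge> 0" and u: "u \<in> L2_space D" and w: "w \<in> L2_space D"
  defines "h \<equiv> \<lambda>x. w x - u x"
  shows "(L2_norm D (S t w))\<^sup>2 = (L2_norm D (S t u))\<^sup>2 + 2 * L2_inner D (S (t + t) u) h + (L2_norm D (S t h))\<^sup>2"
proof -
  have op: "bounded_op D (S t)" by (rule C0_semigroup_bounded_op[OF C0 t])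
  have h: "h \<in> L2_space D" unfolding h_def by (rule L2_space_diff[OF w u])
  have "AE x in D. S t w x = S t u x + S t h x"
    using bounded_op_diff[OF op w u] by eventually_elim (simp add: h_def)
  then have "L2_norm D (S t w) = L2_norm D (\<lambda>x. S t u x + S t h x)"
    using t u w h by (intro L2_norm_cong_AE L2_space_measurable L2_space_add S_L2)
  then have "(L2_norm D (S t w))\<^sup>2 = (L2_norm D (S t u))\<^sup>2 + 2 * L2_inner D (S t u) (S t h) + (L2_norm D (S t h))\<^sup>2"
    using L2_norm_add_square[OF S_L2[OF t u] S_L2[OF t h]] by simp
  also have "L2_inner D (S t u) (S t h) = L2_inner D (S t (S t u)) h"
    by (rule symmetric[OF t S_L2[OF t u] h, symmetric])
  also have "\<dots> = L2_inner D (S (t + t) u) h"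
    using t u h AE_symmetric[OF semigroup_step[OF C0 t t u]]
    by (intro L2_inner_cong_AE L2_space_measurable S_L2) auto
  finally show ?thesis .
qed

text \<open>$S(\tau/2) = S(\tau/4)S(\tau/4)$ and $S(\tau/4)$ is a contraction.\<close>

lemma kinetic_nonpos:
  assumes u: "u \<in> L2_space D" shows "kinetic u \<le> 0"
proof -
  have t: "0 \<le> \<tau>/4" using tau by simp
  have "L2_norm D (S (\<tau>/2) u) = L2_norm D (S (\<tau>/4) (S (\<tau>/4) u))"
    using semigroup_step[OF C0 t t u] tau u by (intro L2_norm_cong_AE L2_space_measurable S_L2) auto
  also have "\<dots> \<le> L2_norm D (S (\<tau>/4) u)" using t u by (intro contraction S_L2)
  finally have "(L2_norm D (S (\<tau>/2) u))\<^sup>2 \<le> (L2_norm D (S (\<tau>/4) u))\<^sup>2" by (intro power_mono) auto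
  moreover have "0 \<le> (L2_norm D (S (\<tau>/4) u))\<^sup>2" by simp
  ultimately show ?thesis unfolding kinetic_def by linarith
qed

lemma pot_grad_L2:
  assumes u: "u \<in> L2_space D" shows "pot_grad u \<in> L2_space D"
proof (rule L2_space_bounded_by[OF u, where C = "4 * \<kappa> + 6 * \<beta> * M\<^sup>2"])
  have [measurable]: "u \<in> borel_measurable D" "V \<in> borel_measurable D" using u V_meas by (simp_all add: L2_space_def)
  show "pot_grad u \<in> borel_measurable D" unfolding pot_grad_def[abs_def] by measurable
  show "AE x in D. cmod (pot_grad u x) \<le> (4 * \<kappa> + 6 * \<beta> * M\<^sup>2) * cmod (u x)"
    using V_bounds
  proof eventually_elim
    case (elim x)
    have k: "0 \<le> \<kappa>" "V x \<le> \<kappa>" using elim beta by (auto simp: add_increasing2 intro: order_trans[rotated])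
    have "cmod (pot_grad u x) \<le> cmod (2 * of_real (V x) * u x) + cmod (of_real (\<beta> / 2) * f_trunc M (u x)) + cmod (2 * of_real \<kappa> * u x)"
      unfolding pot_grad_def by (intro order_trans[OF norm_triangle_ineq4] add_mono norm_triangle_ineq order_refl)
    also have "\<dots> = 2 * V x * cmod (u x) + \<beta> / 2 * cmod (f_trunc M (u x)) + 2 * \<kappa> * cmod (u x)"
      using elim k beta by (simp add: norm_mult)
    also have "\<dots> \<le> 2 * \<kappa> * cmod (u x) + \<beta> / 2 * (12 * M\<^sup>2 * cmod (u x)) + 2 * \<kappa> * cmod (u x)"
      using elim k beta f_trunc_bound[OF M, of "u x"] by (intro add_mono mult_right_mono mult_left_mono) auto
    finally show ?case by (simp add: algebra_simps)
  qed
qed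

lemma pot_density_integrable:
  assumes u: "u \<in> L2_space D" shows "integrable D (pot_density u)"
proof (rule Bochner_Integration.integrable_bound)
  have [measurable]: "u \<in> borel_measurable D" "V \<in> borel_measurable D" using u V_meas by (simp_all add: L2_space_def)
  show "pot_density u \<in> borel_measurable D" unfolding pot_density_def[abs_def] by measurable
  show "integrable D (\<lambda>x. (2 * \<kappa> + 3 * \<beta> * M\<^sup>2) * (cmod (u x))\<^sup>2)"
    by (intro integrable_mult_right L2_space_integrable u)
  show "AE x in D. norm (pot_density u x) \<le> norm ((2 * \<kappa> + 3 * \<beta> * M\<^sup>2) * (cmod (u x))\<^sup>2)"
    using V_bounds
  proof eventually_elim
    case (elim x)
    have k: "0 \<le> \<kappa>" "V x \<le> \<kappa>" using elim beta by (auto simp: add_increasing2 intro: order_trans[rotated])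
    have "0 \<le> V x * (cmod (u x))\<^sup>2" "V x * (cmod (u x))\<^sup>2 \<le> \<kappa> * (cmod (u x))\<^sup>2"
      using elim k by (auto intro: mult_right_mono)
    moreover have "0 \<le> \<beta> / 2 * F_trunc M (u x)" "\<beta> / 2 * F_trunc M (u x) \<le> \<beta> / 2 * (6 * M\<^sup>2 * (cmod (u x))\<^sup>2)"
      using F_trunc_bounds[OF M, of "u x"] beta by (auto intro: mult_left_mono)
    moreover have "\<beta> / 2 * (6 * M\<^sup>2 * (cmod (u x))\<^sup>2) = 3 * \<beta> * M\<^sup>2 * (cmod (u x))\<^sup>2" by simp
    ultimately have "\<bar>pot_density u x\<bar> \<le> 2 * (\<kappa> * (cmod (u x))\<^sup>2) + 3 * \<beta> * M\<^sup>2 * (cmod (u x))\<^sup>2"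
      unfolding pot_density_def by linarith
    also have "\<dots> \<le> \<bar>(2 * \<kappa> + 3 * \<beta> * M\<^sup>2) * (cmod (u x))\<^sup>2\<bar>" by (simp add: distrib_right)
    finally show ?case by simp
  qed
qed

text \<open>The quadratic remainder is $(V + 3\beta M^2 - \kappa)|w - u|^2$, and the hypothesis makes it nonpositive.\<close>

lemma pot_density_tangent:
  assumes "V x + 3 * \<beta> * M\<^sup>2 \<le> \<kappa>"
  shows "pot_density w x \<le> pot_density u x + pot_grad u x \<bullet> (w x - u x)"
proof -
  let ?h = "w x - u x"
  have sq: "(cmod (w x))\<^sup>2 = (cmod (u x))\<^sup>2 + 2 * (u x \<bullet> ?h) + (cmod ?h)\<^sup>2"
    by (simp add: power2_norm_eq_inner inner_diff_left inner_diff_right inner_commute)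
  have "\<beta> / 2 * F_trunc M (w x)
      \<le> \<beta> / 2 * (F_trunc M (u x) + f_trunc M (u x) \<bullet> ?h + 6 * M\<^sup>2 * (cmod ?h)\<^sup>2)"
    using F_trunc_tangent[OF M] beta by (intro mult_left_mono) auto
  moreover have "(V x + 3 * \<beta> * M\<^sup>2) * (cmod ?h)\<^sup>2 \<le> \<kappa> * (cmod ?h)\<^sup>2"
    using assms by (rule mult_right_mono) simp
  moreover have "pot_grad u x \<bullet> ?h = 2 * V x * (u x \<bullet> ?h) + \<beta> / 2 * (f_trunc M (u x) \<bullet> ?h) - 2 * \<kappa> * (u x \<bullet> ?h)"
  proof -
    have "pot_grad u x = (2 * V x) *\<^sub>R u x + (\<beta> / 2) *\<^sub>R f_trunc M (u x) - (2 * \<kappa>) *\<^sub>R u x"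
      by (simp add: pot_grad_def scaleR_conv_of_real)
    then show ?thesis by (simp add: inner_add_left inner_diff_left)
  qed
  ultimately show ?thesis
    unfolding pot_density_def sq by (simp add: algebra_simps)
qed

lemma energy_split:
  assumes u: "u \<in> L2_space D"
  shows "energy D S V \<beta> M \<kappa> \<tau> u
    = 3 / (2 * \<tau>) + 1 / (2 * \<tau>) * kinetic u + (LINT x|D. pot_density u x) + \<kappa>"
proof -
  have int: "integrable D (\<lambda>x. (cmod (S (\<tau>/2) u x))\<^sup>2)" "integrable D (\<lambda>x. (cmod (S (\<tau>/4) u x))\<^sup>2)"
    using tau u by (intro L2_space_integrable S_L2; simp)+
  have "(LINT x|D. 1 / (2 * \<tau>) * ((cmod (S (\<tau>/2) u x))\<^sup>2 - 4 * (cmod (S (\<tau>/4) u x))\<^sup>2)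
        + V x * (cmod (u x))\<^sup>2 + \<beta> / 2 * F_trunc M (u x) - \<kappa> * (cmod (u x))\<^sup>2)
      = (LINT x|D. 1 / (2 * \<tau>) * ((cmod (S (\<tau>/2) u x))\<^sup>2 - 4 * (cmod (S (\<tau>/4) u x))\<^sup>2) + pot_density u x)"
    by (intro Bochner_Integration.integral_cong) (auto simp: pot_density_def)
  also have "\<dots> = (LINT x|D. 1 / (2 * \<tau>) * ((cmod (S (\<tau>/2) u x))\<^sup>2 - 4 * (cmod (S (\<tau>/4) u x))\<^sup>2)) + (LINT x|D. pot_density u x)"
    by (intro Bochner_Integration.integral_add integrable_mult_right Bochner_Integration.integrable_diff int pot_density_integrable u)
  also have "(LINT x|D. 1 / (2 * \<tau>) * ((cmod (S (\<tau>/2) u x))\<^sup>2 - 4 * (cmod (S (\<tau>/4) u x))\<^sup>2)) = 1 / (2 * \<tau>) * kinetic u"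
    unfolding kinetic_def L2_norm_square' integral_mult_right_zero using int by simp
  finally show ?thesis unfolding energy_def by simp
qed

lemma unnormalized_step_eq:
  "unnormalized_step S V \<beta> M \<kappa> \<tau> u = (\<lambda>x. of_real (1/\<tau>) * (- S \<tau> u x + 4 * S (\<tau>/2) u x) - pot_grad u x)"
  by (rule ext) (simp add: unnormalized_step_def pot_grad_def)

lemma unnormalized_step_L2:
  assumes u: "u \<in> L2_space D" shows "unnormalized_step S V \<beta> M \<kappa> \<tau> u \<in> L2_space D"
  unfolding unnormalized_step_eq
  using L2_space_lincomb[OF S_L2[OF _ u, of \<tau>] S_L2[OF _ u, of "\<tau>/2"], of "-1" 4] tau
  by (intro L2_space_diff L2_space_cmult pot_grad_L2 u) simp

text \<open>Concavity of the energy: it lies below its tangent at \<open>u\<close>, whose slope is minus the unnormalised step.\<close>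

lemma energy_tangent:
  assumes u: "u \<in> L2_space D" and w: "w \<in> L2_space D"
  shows "energy D S V \<beta> M \<kappa> \<tau> w
    \<le> energy D S V \<beta> M \<kappa> \<tau> u - L2_inner D (unnormalized_step S V \<beta> M \<kappa> \<tau> u) (\<lambda>x. w x - u x)"
proof -
  define h where "h = (\<lambda>x. w x - u x)"
  have h: "h \<in> L2_space D" unfolding h_def by (rule L2_space_diff[OF w u])
  have St: "S \<tau> u \<in> L2_space D" "S (\<tau>/2) u \<in> L2_space D" using tau u by (auto intro: S_L2)
  let ?K = "\<lambda>x. - S \<tau> u x + 4 * S (\<tau>/2) u x"
  have K: "?K \<in> L2_space D" using L2_space_lincomb[OF St, of "-1" 4] by simp
  have Kh: "L2_inner D ?K h = - L2_inner D (S \<tau> u) h + 4 * L2_inner D (S (\<tau>/2) u) h"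
    using L2_inner_add_left[OF L2_space_cmult[OF St(1), of "of_real (-1)"] L2_space_cmult[OF St(2), of "of_real 4"] h]
    unfolding L2_inner_scale_left by simp
  have "kinetic w = kinetic u - 2 * L2_inner D ?K h + kinetic h"
    unfolding kinetic_def Kh using norm_S_add[OF _ u w, of "\<tau>/2"] norm_S_add[OF _ u w, of "\<tau>/4"] tau
    unfolding h_def[symmetric] by simp
  then have "kinetic w \<le> kinetic u - 2 * L2_inner D ?K h" using kinetic_nonpos[OF h] by linarith
  then have "1 / (2 * \<tau>) * kinetic w \<le> 1 / (2 * \<tau>) * (kinetic u - 2 * L2_inner D ?K h)"
    using tau by (intro mult_left_mono) auto
  also have "\<dots> = 1 / (2 * \<tau>) * kinetic u - 1 / \<tau> * L2_inner D ?K h"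
    using tau by (simp add: field_simps)
  finally have kin: "1 / (2 * \<tau>) * kinetic w \<le> 1 / (2 * \<tau>) * kinetic u - 1 / \<tau> * L2_inner D ?K h" .
  have int: "integrable D (\<lambda>x. pot_grad u x \<bullet> h x)" by (intro integrable_L2_inner pot_grad_L2 u h)
  have "(LINT x|D. pot_density w x) \<le> (LINT x|D. pot_density u x + pot_grad u x \<bullet> h x)"
  proof (rule integral_mono_AE)
    show "AE x in D. pot_density w x \<le> pot_density u x + pot_grad u x \<bullet> h x"
      using V_bounds by eventually_elim (auto simp: h_def intro: pot_density_tangent)
  qed (intro Bochner_Integration.integrable_add pot_density_integrable int u w)+
  also have "\<dots> = (LINT x|D. pot_density u x) + L2_inner D (pot_grad u) h"
    unfolding L2_inner_def by (intro Bochner_Integration.integral_add pot_density_integrable u int)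
  finally have pot: "(LINT x|D. pot_density w x) \<le> (LINT x|D. pot_density u x) + L2_inner D (pot_grad u) h" .
  have "L2_inner D (unnormalized_step S V \<beta> M \<kappa> \<tau> u) h = 1 / \<tau> * L2_inner D ?K h - L2_inner D (pot_grad u) h"
    unfolding unnormalized_step_eq L2_inner_scale_left[symmetric]
    by (intro L2_inner_diff_left L2_space_cmult K pot_grad_L2 u h)
  then show ?thesis
    unfolding energy_split[OF u] energy_split[OF w] h_def[symmetric] using kin pot by linarith
qed

text \<open>The normalised step maximises the linear functional given by $G(u)$ over the unit ball, and \<open>u\<close> competes
in this ball. The second conclusion propagates the norm bound.\<close>

lemma energy_decay:
  assumes u: "u \<in> L2_space D" "L2_norm D u \<le> 1" and w: "w \<in> L2_space D"
    and step: "AE x in D. w x = unnormalized_step S V \<beta> M \<kappa> \<tau> u x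
      / of_real (L2_norm D (unnormalized_step S V \<beta> M \<kappa> \<tau> u))"
  shows "energy D S V \<beta> M \<kappa> \<tau> w \<le> energy D S V \<beta> M \<kappa> \<tau> u" and "L2_norm D w \<le> 1"
proof -
  define G where "G = unnormalized_step S V \<beta> M \<kappa> \<tau> u"
  define g where "g = L2_norm D G"
  have G: "G \<in> L2_space D" unfolding G_def by (rule unnormalized_step_L2[OF u(1)])
  let ?w = "\<lambda>x. of_real (1 / g) * G x"
  have w': "?w \<in> L2_space D" by (rule L2_space_cmult[OF G])
  have ae: "AE x in D. w x = ?w x" using step by (simp add: G_def g_def)
  have "L2_norm D w = L2_norm D ?w" by (intro L2_norm_cong_AE L2_space_measurable w w' ae)
  also have "\<dots> = \<bar>1 / g\<bar> * g" unfolding L2_norm_cmult by (simp only: norm_of_real g_def)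
  \<comment> \<open>The norm is one, or zero if \<open>g = 0\<close>, since then \<open>1 / g = 0\<close>.\<close>
  finally show "L2_norm D w \<le> 1" by (simp add: g_def)
  have "L2_inner D G w = L2_inner D G ?w"
    by (intro L2_inner_cong_AE L2_space_measurable G w w' ae) simp
  also have "\<dots> = 1 / g * g\<^sup>2"
    unfolding g_def L2_norm_square by (subst L2_inner_commute) (rule L2_inner_scale_left)
  also have "\<dots> = g" by (simp add: power2_eq_square)
  finally have Gw: "L2_inner D G w = g" .
  have "\<bar>L2_inner D G u\<bar> \<le> g * L2_norm D u" unfolding g_def by (rule L2_Cauchy_Schwarz[OF G u(1)])
  also have "\<dots> \<le> g * 1" using u(2) by (intro mult_left_mono) (auto simp: g_def)
  finally have "L2_inner D G u \<le> g" by simp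
  then have "0 \<le> L2_inner D G (\<lambda>x. w x - u x)"
    using Gw by (simp add: L2_inner_diff_right w u(1) G)
  then show "energy D S V \<beta> M \<kappa> \<tau> w \<le> energy D S V \<beta> M \<kappa> \<tau> u"
    using energy_tangent[OF u(1) w] unfolding G_def by linarith
qed

end

text \<open>The iteration determines each iterate only up to null sets; completeness of Lebesgue measure makes the
iterates measurable all the same.\<close>

lemma lebesgue_on_measurable_AE:
  fixes f g :: "'a::euclidean_space \<Rightarrow> 'b::euclidean_space"
  assumes f: "f \<in> borel_measurable (lebesgue_on A)" and A: "A \<in> sets lebesgue"
    and ae: "AE x in lebesgue_on A. f x = g x"
  shows "g \<in> borel_measurable (lebesgue_on A)"
proof -
  have "AE x in lebesgue. x \<in> A \<longrightarrow> f x = g x"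
    using ae A by (subst (asm) AE_restrict_space_iff) auto
  then have "AE x in lebesgue. (if x \<in> A then f x else 0) = (if x \<in> A then g x else 0)"
    by eventually_elim auto
  moreover have "(\<lambda>x. if x \<in> A then f x else 0) \<in> borel_measurable lebesgue"
    using f by (simp only: borel_measurable_if[OF A])
  ultimately have "(\<lambda>x. if x \<in> A then g x else 0) \<in> borel_measurable lebesgue"
    by (rule borel_measurable_AE[rotated])
  then show ?thesis by (simp only: borel_measurable_if[OF A])
qed

theorem theorem2p13:
  fixes a b :: "real ^ 'd"
    and D :: "(real ^ 'd) measure"
    and S :: "real \<Rightarrow> (real ^ 'd \<Rightarrow> complex) \<Rightarrow> real ^ 'd \<Rightarrow> complex"
    and V :: "real ^ 'd \<Rightarrow> real"
    and \<tau> \<beta> M \<kappa> :: real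
    and \<phi> :: "nat \<Rightarrow> real ^ 'd \<Rightarrow> complex"
    and n :: nat
  assumes dim: "CARD('d) \<in> {1, 2, 3}"
    and box: "\<And>i. a $ i < b $ i"
    and D: "D = lebesgue_on (box a b)"
    and heat: "heat_semigroup a b S"
    and tau: "\<tau> > 0"
    and beta: "\<beta> > 0"
    and V_meas: "V \<in> borel_measurable D"
    and V_Linf: "Linf_norm D V < \<infinity>"
    and V_nonneg: "AE x in D. V x \<ge> 0"
    and M: "M > 0"
    and kappa: "ereal \<kappa> \<ge> Linf_norm D V + ereal (3 * \<beta> * M\<^sup>2)"
    and phi0: "\<phi> 0 \<in> L2_space D" "L2_norm D (\<phi> 0) = 1"
    and step: "\<And>n. AE x in D. \<phi> (Suc n) x =
        unnormalized_step S V \<beta> M \<kappa> \<tau> (\<phi> n) x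
        / of_real (L2_norm D (unnormalized_step S V \<beta> M \<kappa> \<tau> (\<phi> n)))"
  shows "energy D S V \<beta> M \<kappa> \<tau> (\<phi> (Suc n)) \<le> energy D S V \<beta> M \<kappa> \<tau> (\<phi> n)"
proof -
  have V_bounds: "AE x in D. 0 \<le> V x \<and> V x + 3 * \<beta> * M\<^sup>2 \<le> \<kappa>"
    using V_nonneg esssup_AE[of "\<lambda>x. ereal \<bar>V x\<bar>" D]
  proof eventually_elim
    case (elim x)
    have "ereal (V x + 3 * \<beta> * M\<^sup>2) = ereal \<bar>V x\<bar> + ereal (3 * \<beta> * M\<^sup>2)" using elim by simp
    also have "\<dots> \<le> Linf_norm D V + ereal (3 * \<beta> * M\<^sup>2)"
      using elim by (intro add_right_mono) (simp add: Linf_norm_def)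
    also have "\<dots> \<le> ereal \<kappa>" by (rule kappa)
    finally show ?case using elim by simp
  qed
  interpret relaxed_energy D S V \<tau> \<beta> M \<kappa>
    using heat heat_semigroup_symmetric[OF box heat] heat_semigroup_contraction[OF box heat]
      tau beta M V_meas V_bounds
    by unfold_locales (simp_all add: D heat_semigroup_def)
  have "\<phi> n \<in> L2_space D \<and> L2_norm D (\<phi> n) \<le> 1" for n
  proof (induction n)
    case 0
    then show ?case using phi0 by simp
  next
    case (Suc n)
    let ?G = "unnormalized_step S V \<beta> M \<kappa> \<tau> (\<phi> n)"
    let ?w = "\<lambda>x. of_real (1 / L2_norm D ?G) * ?G x"
    have w: "?w \<in> L2_space D" using Suc by (intro L2_space_cmult unnormalized_step_L2) simp
    have ae: "AE x in D. \<phi> (Suc n) x = ?w x" using step[of n] by simp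
    have "\<phi> (Suc n) \<in> borel_measurable D"
      using lebesgue_on_measurable_AE[OF L2_space_measurable[OF w[unfolded D]] _ AE_symmetric[OF ae[unfolded D]]]
      by (simp add: D)
    then have "\<phi> (Suc n) \<in> L2_space D"
      by (rule L2_space_bounded_by[OF w, where C = 1]) (use ae in \<open>eventually_elim, simp\<close>)
    then show ?case using energy_decay(2)[OF _ _ _ step] Suc by blast
  qed
  then show ?thesis using energy_decay(1)[OF _ _ _ step] by blast
qed

end
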